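(* Let $S=\{\sigma_0<\sigma_1<\cdots<\sigma_N\}$ be a totally ordered set of length $N$, let $\mathfrak{b}$ be a set of bonds on $S$, and let $A$ be the discrete LS algebra over $(S,\leq,\mathfrak{b})$ with base field $\mathbb{C}$. Then $A$ is (isomorphic as a $\mathbb{C}$-algebra to) the ring of invariants $\mathbb{C}[x_{\sigma_0},\ldots,x_{\sigma_N}]^G$ for the linear action of a finite abelian group $G\subseteq\mathrm{GL}_{N+1}(\mathbb{C})$ on the polynomial ring $\mathbb{C}[x_{\sigma_0},\ldots,x_{\sigma_N}]$. Furthermore $G$ can be chosen to contain no pseudo-reflection.
   Context: Bonds: a set of bonds $\mathfrak{b}$ on the totally ordered set $S=\{\sigma_0<\cdots<\sigma_N\}$ is a choice of a positive integer $\mathfrak{b}(\sigma_i,\sigma_{i+1})$ for each $i=0,\ldots,N-1$. It is extended to all pairs $\sigma_i<\sigma_j$ by $\mathfrak{b}(\sigma_i,\sigma_j)=\gcd_{i\leq k\leq j-1}\mathfrak{b}(\sigma_k,\sigma_{k+1})$. LS-paths: a function $\pi:S\to\mathbb{Q}$ is an LS-path of degree $r\in\mathbb{N}=\{0,1,2,\ldots\}$ if (1) $\pi(\sigma)\geq 0$ for all $\sigma\in S$, and (2) if $\mathrm{supp}\,\pi=\{\sigma\in S\mid \pi(\sigma)\neq 0\}=\{\tau_1<\cdots<\tau_n\}$, then $\mathfrak{b}(\tau_j,\tau_{j+1})\sum_{i=1}^j\pi(\tau_i)\in\mathbb{N}$ for $j=1,\ldots,n-1$ and $\sum_{i=1}^n\pi(\tau_i)=r$.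 The sum $\pi\dotplus\pi'$ of two LS-paths as functions on $S$ is again an LS-path, of degree $\deg\pi+\deg\pi'$. Standard monomials: a formal commutative monomial $\pi_1\cdots\pi_r$ of degree $1$ LS-paths is standard if (up to reordering) $\max\mathrm{supp}\,\pi_h\leq\min\mathrm{supp}\,\pi_{h+1}$ for $h=1,\ldots,r-1$. Every LS-path $\pi$ of degree $r$ can be written uniquely as $\pi=\pi_{0,1}\dotplus\cdots\dotplus\pi_{0,r}$ with $\pi_{0,1}\cdots\pi_{0,r}$ a standard monomial of degree $1$ LS-paths; this is the canonical form of $\pi$, and of any monomial $\pi_1\cdots\pi_r$ of degree $1$ LS-paths with $\pi_1\dotplus\cdots\dotplus\pi_r=\pi$. Discrete LS algebra over $(S,\leq,\mathfrak{b})$ ($S$ totally ordered, base field $\mathbb{C}$): the commutative graded $\mathbb{C}$-algebra having the set of all LS-paths as $\mathbb{C}$-basis, graded by the degree of LS-paths, in which an LS-path with canonical form $\pi_{0,1}\dotplus\cdots\dotplus\pi_{0,r}$ equals the product $\pi_{0,1}\cdots\pi_{0,r}$, and in which for every non-standard monomial $\pi_1\pi_2$ of degree $1$ LS-paths one has $\pi_1\pi_2=\pi_{0,1}\pi_{0,2}$, where $\pi_{0,1}\pi_{0,2}$ is the canonical form of $\pi_1\pi_2$. Equivalently the product of two basis elements $\pi,\pi'$ is $\pi\dotplus\pi'$. A pseudo-reflection is a non-identity element of finite order of $\mathrm{GL}_{N+1}(\mathbb{C})$ all of whose eigenvalues but one are equal to $1$ (equivalently, fixing a hyperplane pointwise).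 *)

theory Defs
  imports
    "HOL-Analysis.Analysis"
    "HOL-Library.Poly_Mapping"
    "HOL-Library.Function_Algebras"
    "HOL-Library.Multiset"
    "HOL-Algebra.Module"
    "HOL-Algebra.QuotRing"
begin

section \<open>Bonds and LS-paths\<close>

text \<open>
  The finite totally ordered set is (the universe of) a type of sort
  \<^class>\<open>finite\<close>, \<^class>\<open>linorder\<close>; its number of elements
  is \<open>N + 1\<close>.
\<close>

definition adjacent_in :: "'s::linorder set \<Rightarrow> 's \<Rightarrow> 's \<Rightarrow> bool" where
  "adjacent_in X \<sigma> \<tau> \<longleftrightarrow>
     \<sigma> \<in> X \<and> \<tau> \<in> X \<and> \<sigma> < \<tau> \<and> \<not> (\<exists>\<rho>\<in>X. \<sigma> < \<rho> \<and> \<rho> < \<tau>)"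

text \<open>Only the values of \<open>b\<close> on adjacent pairs \<open>\<sigma>\<^sub>i < \<sigma>\<^sub>i\<^sub>+\<^sub>1\<close> carry information.\<close>

definition is_bonds :: "('s::linorder \<Rightarrow> 's \<Rightarrow> nat) \<Rightarrow> bool" where
  "is_bonds b \<longleftrightarrow> (\<forall>\<sigma> \<tau>. adjacent_in UNIV \<sigma> \<tau> \<longrightarrow> 0 < b \<sigma> \<tau>)"

definition bond_ext :: "('s::linorder \<Rightarrow> 's \<Rightarrow> nat) \<Rightarrow> 's \<Rightarrow> 's \<Rightarrow> nat" where
  "bond_ext b \<sigma> \<tau> = Gcd {b \<rho> \<rho>' | \<rho> \<rho>'. adjacent_in UNIV \<rho> \<rho>' \<and> \<sigma> \<le> \<rho> \<and> \<rho>' \<le> \<tau>}"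

definition supp :: "('s \<Rightarrow> rat) \<Rightarrow> 's set" where
  "supp \<pi> = {\<sigma>. \<pi> \<sigma> \<noteq> 0}"

definition LS_path :: "('s::{finite,linorder} \<Rightarrow> 's \<Rightarrow> nat) \<Rightarrow> nat \<Rightarrow> ('s \<Rightarrow> rat) \<Rightarrow> bool" where
  "LS_path b r \<pi> \<longleftrightarrow>
     (\<forall>\<sigma>. 0 \<le> \<pi> \<sigma>) \<and>
     (\<forall>\<sigma> \<tau>. adjacent_in (supp \<pi>) \<sigma> \<tau> \<longrightarrow>
        of_nat (bond_ext b \<sigma> \<tau>) * (\<Sum>\<rho>\<in>{\<rho> \<in> supp \<pi>. \<rho> \<le> \<sigma>}. \<pi> \<rho>) \<in> \<nat>) \<and>
     (\<Sum>\<rho>\<in>supp \<pi>. \<pi> \<rho>) = of_nat r"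

definition LS_paths :: "('s::{finite,linorder} \<Rightarrow> 's \<Rightarrow> nat) \<Rightarrow> ('s \<Rightarrow> rat) set" where
  "LS_paths b = {\<pi>. \<exists>r. LS_path b r \<pi>}"

text \<open>
  A monomial of degree 1 LS-paths is a multiset. The sum of LS-paths is the pointwise sum,
  so \<^term>\<open>sum_list ps\<close> is the LS-path whose canonical form is \<open>ps\<close>
  whenever \<^prop>\<open>standard_seq b ps\<close> for the predicate below.
\<close>

definition standard_seq :: "('s::{finite,linorder} \<Rightarrow> 's \<Rightarrow> nat) \<Rightarrow> ('s \<Rightarrow> rat) list \<Rightarrow> bool" where
  "standard_seq b ps \<longleftrightarrow>
     (\<forall>p\<in>set ps. LS_path b 1 p) \<and>
     (\<forall>h. Suc h < length ps \<longrightarrow> Max (supp (ps ! h)) \<le> Min (supp (ps ! Suc h)))"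

definition standard_monomial ::
    "('s::{finite,linorder} \<Rightarrow> 's \<Rightarrow> nat) \<Rightarrow> ('s \<Rightarrow> rat) multiset \<Rightarrow> bool" where
  "standard_monomial b M \<longleftrightarrow> (\<exists>ps. mset ps = M \<and> standard_seq b ps)"


section \<open>Discrete LS algebras\<close>

definition complex_field :: "complex ring" where
  "complex_field = \<lparr>carrier = UNIV, monoid.mult = (*), one = 1, zero = 0, add = (+)\<rparr>"

definition lincomb ::
    "(complex, 'a, 'm) module_scheme \<Rightarrow> ('i \<Rightarrow> 'a) \<Rightarrow> ('i \<Rightarrow>\<^sub>0 complex) \<Rightarrow> 'a" where
  "lincomb A e c = finsum A (\<lambda>i. Poly_Mapping.lookup c i \<odot>\<^bsub>A\<^esub> e i) (Poly_Mapping.keys c)"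

definition LS_component ::
    "('s::{finite,linorder} \<Rightarrow> 's \<Rightarrow> nat) \<Rightarrow> (complex, 'a, 'm) module_scheme \<Rightarrow>
     (('s \<Rightarrow> rat) \<Rightarrow> 'a) \<Rightarrow> nat \<Rightarrow> 'a set" where
  "LS_component b A e r = lincomb A e ` {c. Poly_Mapping.keys c \<subseteq> {\<pi>. LS_path b r \<pi>}}"

text \<open>
  The map \<open>e\<close> sends an LS-path to the corresponding element of the algebra; its values
  outside \<^term>\<open>LS_paths b\<close> are irrelevant. The assumption \<open>basis\<close> says that
  every element of the algebra is a linear combination of LS-paths in exactly one way.
\<close>

locale discrete_LS_algebra = algebra complex_field A
  for b :: "'s::{finite,linorder} \<Rightarrow> 's \<Rightarrow> nat"
    and A :: "(complex, 'a, 'm) module_scheme" (structure)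
    and e :: "('s \<Rightarrow> rat) \<Rightarrow> 'a" +
  assumes e_closed: "\<pi> \<in> LS_paths b \<Longrightarrow> e \<pi> \<in> carrier A"
    and basis: "bij_betw (lincomb A e) {c. Poly_Mapping.keys c \<subseteq> LS_paths b} (carrier A)"
    and graded_one: "\<one> \<in> LS_component b A e 0"
    and graded_mult: "\<lbrakk>x \<in> LS_component b A e r; y \<in> LS_component b A e s\<rbrakk> \<Longrightarrow>
      x \<otimes> y \<in> LS_component b A e (r + s)"
    and canonical_form: "standard_seq b ps \<Longrightarrow> e (sum_list ps) = foldr (\<lambda>p x. e p \<otimes> x) ps \<one>"
    and straightening: "\<lbrakk>LS_path b 1 p1; LS_path b 1 p2; \<not> standard_monomial b {#p1, p2#};
      standard_seq b [q1, q2]; q1 + q2 = p1 + p2\<rbrakk> \<Longrightarrow> e p1 \<otimes> e p2 = e q1 \<otimes> e q2"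

definition algebra_isomorphic ::
    "(complex, 'a, 'm) module_scheme \<Rightarrow> (complex, 'c, 'n) module_scheme \<Rightarrow> bool" where
  "algebra_isomorphic A B \<longleftrightarrow>
     (\<exists>\<phi>\<in>ring_iso A B. \<forall>c. \<forall>x\<in>carrier A. \<phi> (c \<odot>\<^bsub>A\<^esub> x) = c \<odot>\<^bsub>B\<^esub> \<phi> x)"


section \<open>Linear groups acting on polynomial rings\<close>

definition GL :: "(complex ^ 's ^ 's) monoid" where
  "GL = \<lparr>carrier = {g. invertible g}, monoid.mult = (**), one = mat 1\<rparr>"

text \<open>
  The last conjunct says that the eigenvalues of \<open>g\<close>, counted with algebraic multiplicity,
  are \<open>z\<close> and \<open>1\<close> (\<^term>\<open>CARD('s) - 1\<close> times).
  Here \<^term>\<open>mat x\<close> is the scalar matrix.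
\<close>

definition pseudo_reflection :: "complex ^ 's::finite ^ 's \<Rightarrow> bool" where
  "pseudo_reflection g \<longleftrightarrow>
     g \<in> carrier GL \<and> g \<noteq> mat 1 \<and>
     (\<exists>k::nat. 0 < k \<and> g [^]\<^bsub>GL\<^esub> k = \<one>\<^bsub>GL\<^esub>) \<and>
     (\<exists>z. \<forall>x. det (mat x - g) = (x - 1) ^ (CARD('s) - 1) * (x - z))"

text \<open>
  Polynomials in the indeterminates \<open>x\<^sub>\<sigma>\<close>, as finitely supported coefficient
  functions on exponent vectors. The multiplication of \<^type>\<open>poly_mapping\<close> is
  convolution, i.e. multiplication of polynomials.
\<close>

type_synonym 's cpoly = "('s \<Rightarrow>\<^sub>0 nat) \<Rightarrow>\<^sub>0 complex"

definition Const :: "complex \<Rightarrow> 's cpoly" where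
  "Const c = Poly_Mapping.single 0 c"

definition Var :: "'s \<Rightarrow> 's cpoly" where
  "Var \<sigma> = Poly_Mapping.single (Poly_Mapping.single \<sigma> 1) 1"

definition subst :: "('s::finite \<Rightarrow> 's cpoly) \<Rightarrow> 's cpoly \<Rightarrow> 's cpoly" where
  "subst q f = (\<Sum>m\<in>Poly_Mapping.keys f.
     Const (Poly_Mapping.lookup f m) * (\<Prod>\<sigma>\<in>UNIV. q \<sigma> ^ Poly_Mapping.lookup m \<sigma>))"

text \<open>
  The linear action on the span of the indeterminates, regarded as the standard basis,
  extended to polynomials by algebra homomorphisms.
\<close>

definition act :: "complex ^ 's::finite ^ 's \<Rightarrow> 's cpoly \<Rightarrow> 's cpoly" where
  "act g = subst (\<lambda>\<sigma>. \<Sum>\<tau>\<in>UNIV. Const (g $ \<tau> $ \<sigma>) * Var \<tau>)"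

definition invariant_ring :: "(complex ^ 's::finite ^ 's) set \<Rightarrow> (complex, 's cpoly) module" where
  "invariant_ring G =
     \<lparr>carrier = {f. \<forall>g\<in>G. act g f = f}, monoid.mult = (*), one = 1, zero = 0, add = (+),
      smult = (\<lambda>c f. Const c * f)\<rparr>"


section \<open>Existence of discrete LS algebras\<close>

text \<open>
  The semigroup algebra of the LS-paths under pointwise addition satisfies the
  assumptions of \<^locale>\<open>discrete_LS_algebra\<close>.
\<close>

lemma supp_sum:
  fixes \<pi> :: "'s::finite \<Rightarrow> rat"
  shows "(\<Sum>\<rho>\<in>{\<rho> \<in> supp \<pi>. P \<rho>}. \<pi> \<rho>) = (\<Sum>\<rho>\<in>{\<rho>. P \<rho>}. \<pi> \<rho>)"
  by (rule sum.mono_neutral_left) (auto simp: supp_def)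

lemma Nats_of_Ints_nonneg: "(x::rat) \<in> \<int> \<Longrightarrow> 0 \<le> x \<Longrightarrow> x \<in> \<nat>"
  by (simp add: Nats_altdef2)

lemma Gcd_mult_Nats:
  fixes F :: rat
  assumes "finite B" and "0 \<le> F" and "\<And>n. n \<in> B \<Longrightarrow> of_nat n * F \<in> \<nat>"
  shows "of_nat (Gcd B) * F \<in> \<nat>"
  using assms(1,3)
proof (induction B rule: finite_induct)
  case (insert n B)
  let ?g = "Gcd B"
  obtain u v where uv: "u * int n + v * int ?g = gcd (int n) (int ?g)"
    using bezout_int by blast
  have "int (gcd n ?g) = u * int n + v * int ?g"
    by (simp add: uv)
  then have "(of_nat (gcd n ?g) :: rat) = of_int u * of_nat n + of_int v * of_nat ?g"
    by (metis of_int_add of_int_mult of_int_of_nat_eq)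
  then have "of_nat (gcd n ?g) * F = of_int u * (of_nat n * F) + of_int v * (of_nat ?g * F)"
    by (simp add: algebra_simps)
  moreover have "of_nat n * F \<in> \<int>" "of_nat ?g * F \<in> \<int>"
    using insert Nats_subset_Ints by blast+
  ultimately have "of_nat (gcd n ?g) * F \<in> \<int>"
    by simp
  then show ?case
    using assms(2) by (simp add: Nats_of_Ints_nonneg)
qed simp

lemma LS_path_iff:
  fixes b :: "'s::{finite,linorder} \<Rightarrow> 's \<Rightarrow> nat"
  shows "LS_path b r \<pi> \<longleftrightarrow> (\<forall>\<sigma>. 0 \<le> \<pi> \<sigma>) \<and>
     (\<forall>\<sigma> \<tau>. adjacent_in UNIV \<sigma> \<tau> \<longrightarrow> of_nat (b \<sigma> \<tau>) * (\<Sum>\<rho>\<in>{..\<sigma>}. \<pi> \<rho>) \<in> \<nat>) \<and>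
     (\<Sum>\<rho>\<in>UNIV. \<pi> \<rho>) = of_nat r"
proof -
  define F where "F \<sigma> = (\<Sum>\<rho>\<in>{..\<sigma>}. \<pi> \<rho>)" for \<sigma>
  have F_supp: "(\<Sum>\<rho>\<in>{\<rho> \<in> supp \<pi>. \<rho> \<le> \<sigma>}. \<pi> \<rho>) = F \<sigma>" for \<sigma>
    using supp_sum[of \<pi> "\<lambda>\<rho>. \<rho> \<le> \<sigma>"] by (simp add: F_def atMost_def)
  have total: "(\<Sum>\<rho>\<in>supp \<pi>. \<pi> \<rho>) = (\<Sum>\<rho>\<in>UNIV. \<pi> \<rho>)"
    using supp_sum[of \<pi> "\<lambda>_. True"] by simp
  have F_const: "F \<rho> = F \<sigma>" if "\<sigma> \<le> \<rho>" "\<And>\<upsilon>. \<sigma> < \<upsilon> \<Longrightarrow> \<upsilon> \<le> \<rho> \<Longrightarrow> \<pi> \<upsilon> = 0" for \<rho> \<sigma>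
    unfolding F_def by (rule sum.mono_neutral_right) (use that in \<open>auto simp: not_le[symmetric]\<close>)
  have "(\<forall>\<sigma> \<tau>. adjacent_in (supp \<pi>) \<sigma> \<tau> \<longrightarrow> of_nat (bond_ext b \<sigma> \<tau>) * F \<sigma> \<in> \<nat>) \<longleftrightarrow>
        (\<forall>\<sigma> \<tau>. adjacent_in UNIV \<sigma> \<tau> \<longrightarrow> of_nat (b \<sigma> \<tau>) * F \<sigma> \<in> \<nat>)" (is "?L \<longleftrightarrow> ?R")
    if nonneg: "\<forall>\<sigma>. 0 \<le> \<pi> \<sigma>" and deg: "(\<Sum>\<rho>\<in>UNIV. \<pi> \<rho>) = of_nat r"
  proof
    assume L: ?L
    show ?R
    proof (intro allI impI)
      fix \<rho> \<rho>' :: 's assume adj: "adjacent_in UNIV \<rho> \<rho>'"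
      show "of_nat (b \<rho> \<rho>') * F \<rho> \<in> \<nat>"
      proof (cases "\<forall>\<upsilon>\<le>\<rho>. \<pi> \<upsilon> = 0")
        case True
        then have "F \<rho> = 0" by (simp add: F_def)
        then show ?thesis by simp
      next
        case nzl: False
        show ?thesis
        proof (cases "\<forall>\<upsilon>>\<rho>. \<pi> \<upsilon> = 0")
          case True
          have "F \<rho> = (\<Sum>\<rho>\<in>UNIV. \<pi> \<rho>)"
            unfolding F_def by (rule sum.mono_neutral_left) (use True in auto)
          then show ?thesis
            using deg by (simp flip: of_nat_mult)
        next
          case False
          define X where "X = {\<upsilon> \<in> supp \<pi>. \<upsilon> \<le> \<rho>}"
          define Y where "Y = {\<upsilon> \<in> supp \<pi>. \<rho> < \<upsilon>}"
          have fin: "finite X" "finite Y" "X \<noteq> {}" "Y \<noteq> {}"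
            using nzl False by (auto simp: X_def Y_def supp_def)
          define \<sigma> where "\<sigma> = Max X"
          define \<tau> where "\<tau> = Min Y"
          have s: "\<sigma> \<in> supp \<pi>" "\<sigma> \<le> \<rho>" "\<And>\<upsilon>. \<upsilon> \<in> supp \<pi> \<Longrightarrow> \<upsilon> \<le> \<rho> \<Longrightarrow> \<upsilon> \<le> \<sigma>"
            using Max_in[of X] Max_ge[of X] fin by (auto simp: \<sigma>_def X_def)
          have t: "\<tau> \<in> supp \<pi>" "\<rho> < \<tau>" "\<And>\<upsilon>. \<upsilon> \<in> supp \<pi> \<Longrightarrow> \<rho> < \<upsilon> \<Longrightarrow> \<tau> \<le> \<upsilon>"
            using Min_in[of Y] Min_le[of Y] fin by (auto simp: \<tau>_def Y_def)
          have "adjacent_in (supp \<pi>) \<sigma> \<tau>"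
            unfolding adjacent_in_def using s t by (meson leD le_less_trans not_le_imp_less)
          with L have *: "of_nat (bond_ext b \<sigma> \<tau>) * F \<sigma> \<in> \<nat>" by blast
          have "F \<rho> = F \<sigma>"
            by (rule F_const) (use s in \<open>auto simp: supp_def not_le[symmetric]\<close>)
          moreover have "\<rho>' \<le> \<tau>"
            using adj t(2) by (auto simp: adjacent_in_def not_less[symmetric])
          with adj s have "bond_ext b \<sigma> \<tau> dvd b \<rho> \<rho>'"
            unfolding bond_ext_def by (intro Gcd_dvd) blast
          then obtain k where "b \<rho> \<rho>' = bond_ext b \<sigma> \<tau> * k" ..
          then have "of_nat (b \<rho> \<rho>') * F \<sigma> = of_nat k * (of_nat (bond_ext b \<sigma> \<tau>) * F \<sigma>)"
            by simp
          moreover have "of_nat k * (of_nat (bond_ext b \<sigma> \<tau>) * F \<sigma>) \<in> \<nat>"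
            by (rule Nats_mult[OF of_nat_in_Nats *])
          ultimately show ?thesis
            by metis
        qed
      qed
    qed
  next
    assume R: ?R
    show ?L
    proof (intro allI impI)
      fix \<sigma> \<tau> :: 's assume adj: "adjacent_in (supp \<pi>) \<sigma> \<tau>"
      let ?B = "{b \<rho> \<rho>' | \<rho> \<rho>'. adjacent_in UNIV \<rho> \<rho>' \<and> \<sigma> \<le> \<rho> \<and> \<rho>' \<le> \<tau>}"
      have "finite ((\<lambda>(\<rho>, \<rho>'). b \<rho> \<rho>') ` UNIV)" by simp
      then have "finite ?B" by (rule rev_finite_subset) auto
      moreover have "0 \<le> F \<sigma>" using nonneg by (simp add: F_def sum_nonneg)
      moreover have "of_nat n * F \<sigma> \<in> \<nat>" if "n \<in> ?B" for n
      proof -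
        from that obtain \<rho> \<rho>' where n: "n = b \<rho> \<rho>'" "adjacent_in UNIV \<rho> \<rho>'" "\<sigma> \<le> \<rho>" "\<rho>' \<le> \<tau>"
          by blast
        have "\<rho> < \<tau>" using n by (auto simp: adjacent_in_def)
        have "F \<rho> = F \<sigma>"
          by (rule F_const) (use n \<open>\<rho> < \<tau>\<close> adj in \<open>auto simp: adjacent_in_def supp_def\<close>)
        with R n show ?thesis by metis
      qed
      ultimately show "of_nat (bond_ext b \<sigma> \<tau>) * F \<sigma> \<in> \<nat>"
        unfolding bond_ext_def by (rule Gcd_mult_Nats)
    qed
  qed
  then show ?thesis
    unfolding LS_path_def F_supp total F_def[symmetric] by blast
qed

lemma LS_path_zero: "LS_path b 0 0"
  by (simp add: LS_path_iff)

lemma LS_path_add: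
  assumes "LS_path b r \<pi>" and "LS_path b s \<pi>'"
  shows "LS_path b (r + s) (\<pi> + \<pi>')"
  using assms by (auto simp: LS_path_iff sum.distrib distrib_left)

definition LS_semigroup_algebra ::
    "('s::{finite,linorder} \<Rightarrow> 's \<Rightarrow> nat) \<Rightarrow> (complex, ('s \<Rightarrow> rat) \<Rightarrow>\<^sub>0 complex) module" where
  "LS_semigroup_algebra b =
     \<lparr>carrier = {c. Poly_Mapping.keys c \<subseteq> LS_paths b}, monoid.mult = (*), one = 1,
      zero = 0, add = (+), smult = (\<lambda>a c. Poly_Mapping.single 0 a * c)\<rparr>"

lemma sum_single: "(\<Sum>i\<in>Poly_Mapping.keys c. Poly_Mapping.single i (Poly_Mapping.lookup c i)) = c"
proof (rule poly_mapping_eqI)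
  fix k
  have "(\<Sum>i\<in>Poly_Mapping.keys c. Poly_Mapping.lookup (Poly_Mapping.single i (Poly_Mapping.lookup c i)) k) =
        (\<Sum>i\<in>Poly_Mapping.keys c. if i = k then Poly_Mapping.lookup c k else 0)"
    by (rule sum.cong) (auto simp: lookup_single when_def)
  also have "\<dots> = Poly_Mapping.lookup c k"
    by (simp add: in_keys_iff)
  finally show "Poly_Mapping.lookup
      (\<Sum>i\<in>Poly_Mapping.keys c. Poly_Mapping.single i (Poly_Mapping.lookup c i)) k =
      Poly_Mapping.lookup c k"
    by (simp add: lookup_sum)
qed

lemma keys_mult_LS:
  fixes b :: "'s::{finite,linorder} \<Rightarrow> 's \<Rightarrow> nat"
  assumes "Poly_Mapping.keys c \<subseteq> {\<pi>. LS_path b r \<pi>}" "Poly_Mapping.keys d \<subseteq> {\<pi>. LS_path b s \<pi>}"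
  shows "Poly_Mapping.keys (c * d :: _ \<Rightarrow>\<^sub>0 complex) \<subseteq> {\<pi>. LS_path b (r + s) \<pi>}"
  using keys_mult[of c d] assms LS_path_add by blast

theorem discrete_LS_algebra_semigroup_algebra:
  "discrete_LS_algebra b (LS_semigroup_algebra b) (\<lambda>\<pi>. Poly_Mapping.single \<pi> 1)"
proof -
  let ?A = "LS_semigroup_algebra b"
  let ?e = "\<lambda>\<pi> :: 'a \<Rightarrow> rat. Poly_Mapping.single \<pi> (1::complex)"
  have add: "\<pi> + \<pi>' \<in> LS_paths b" if "\<pi> \<in> LS_paths b" "\<pi>' \<in> LS_paths b" for \<pi> \<pi>'
    using that LS_path_add unfolding LS_paths_def by blast
  have zero: "0 \<in> LS_paths b"
    using LS_path_zero unfolding LS_paths_def by blast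
  have mult: "Poly_Mapping.keys (c * d :: _ \<Rightarrow>\<^sub>0 complex) \<subseteq> LS_paths b"
    if "Poly_Mapping.keys c \<subseteq> LS_paths b" "Poly_Mapping.keys d \<subseteq> LS_paths b" for c d
    using keys_mult[of c d] that add by blast
  have scal: "Poly_Mapping.keys (Poly_Mapping.single 0 a :: _ \<Rightarrow>\<^sub>0 complex) \<subseteq> LS_paths b" for a
    using zero by simp
  have R: "cring complex_field"
    by (rule cringI, rule abelian_groupI, unfold comm_monoid_def monoid_def comm_monoid_axioms_def)
      (auto simp: complex_field_def algebra_simps intro: exI[of _ "- x" for x])
  have M: "cring ?A"
  proof (rule cringI)
    show "abelian_group ?A"
    proof (rule abelian_groupI)
      fix x assume "x \<in> carrier ?A"
      then show "\<exists>y\<in>carrier ?A. y \<oplus>\<^bsub>?A\<^esub> x = \<zero>\<^bsub>?A\<^esub>"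
        by (intro bexI[of _ "- x"]) (auto simp: LS_semigroup_algebra_def)
    next
      fix x y assume "x \<in> carrier ?A" "y \<in> carrier ?A"
      then show "x \<oplus>\<^bsub>?A\<^esub> y \<in> carrier ?A"
        using Poly_Mapping.keys_add[of x y] by (auto simp: LS_semigroup_algebra_def)
    qed (auto simp: LS_semigroup_algebra_def algebra_simps)
    show "Group.comm_monoid ?A"
      by (rule comm_monoidI)
        (auto simp: LS_semigroup_algebra_def algebra_simps zero dest: mult[THEN subsetD, rotated 2])
  qed (auto simp: LS_semigroup_algebra_def algebra_simps)
  interpret algebra complex_field ?A
  proof (rule algebraI[OF R M])
    fix a x assume "x \<in> carrier ?A"
    then show "a \<odot>\<^bsub>?A\<^esub> x \<in> carrier ?A"
      using mult[OF scal] by (simp add: LS_semigroup_algebra_def)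
  qed (auto simp: LS_semigroup_algebra_def complex_field_def algebra_simps single_add mult_single
      simp flip: mult.assoc)
  have carr: "carrier ?A = {c. Poly_Mapping.keys c \<subseteq> LS_paths b}"
    by (simp add: LS_semigroup_algebra_def)
  have fs: "finsum ?A f I = sum f I" if "finite I" "f ` I \<subseteq> carrier ?A" for f I
    using that
  proof (induction I rule: finite_induct)
    case empty
    then show ?case by (subst M.finsum_empty) (simp add: LS_semigroup_algebra_def)
  next
    case (insert i I)
    then show ?case
      by (subst M.finsum_insert) (auto simp: LS_semigroup_algebra_def)
  qed
  have lc: "lincomb ?A ?e c = c" if "Poly_Mapping.keys c \<subseteq> LS_paths b" for c
  proof -
    have "lincomb ?A ?e c =
        (\<Sum>i\<in>Poly_Mapping.keys c. Poly_Mapping.single i (Poly_Mapping.lookup c i))"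
      unfolding lincomb_def using that
      by (subst fs) (auto simp: LS_semigroup_algebra_def mult_single split: if_splits)
    then show ?thesis
      by (simp add: sum_single)
  qed
  have comp: "LS_component b ?A ?e r = {c. Poly_Mapping.keys c \<subseteq> {\<pi>. LS_path b r \<pi>}}" for r
  proof -
    have "lincomb ?A ?e c = c" if "Poly_Mapping.keys c \<subseteq> {\<pi>. LS_path b r \<pi>}" for c
      using that by (intro lc) (auto simp: LS_paths_def)
    then show ?thesis
      unfolding LS_component_def by (auto simp: image_iff)
  qed
  have prod: "foldr (\<lambda>p x. ?e p \<otimes>\<^bsub>?A\<^esub> x) ps \<one>\<^bsub>?A\<^esub> = ?e (sum_list ps)" for ps
  proof (induction ps)
    case Nil
    then show ?case by (simp add: LS_semigroup_algebra_def zero_fun_def flip: single_one)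
  next
    case (Cons p ps)
    have "?e p * ?e (sum_list ps) = ?e (p + sum_list ps)"
      by (simp only: mult_single mult_1)
    with Cons show ?case
      by (simp add: LS_semigroup_algebra_def plus_fun_def)
  qed
  show ?thesis
  proof unfold_locales
    fix \<pi> assume "\<pi> \<in> LS_paths b"
    then show "?e \<pi> \<in> carrier ?A" by (simp add: LS_semigroup_algebra_def)
  next
    show "bij_betw (lincomb ?A ?e) {c. Poly_Mapping.keys c \<subseteq> LS_paths b} (carrier ?A)"
      by (rule bij_betwI[where g = "\<lambda>c. c"]) (auto simp: lc carr)
  next
    show "\<one>\<^bsub>?A\<^esub> \<in> LS_component b ?A ?e 0"
      unfolding comp using LS_path_zero by (auto simp: LS_semigroup_algebra_def)
  next
    fix x y r s assume "x \<in> LS_component b ?A ?e r" "y \<in> LS_component b ?A ?e s"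
    then show "x \<otimes>\<^bsub>?A\<^esub> y \<in> LS_component b ?A ?e (r + s)"
      unfolding comp using keys_mult_LS[of x b r y s] by (simp add: LS_semigroup_algebra_def)
  next
    fix ps show "?e (sum_list ps) = foldr (\<lambda>p x. ?e p \<otimes>\<^bsub>?A\<^esub> x) ps \<one>\<^bsub>?A\<^esub>"
      by (simp add: prod)
  next
    fix p1 p2 q1 q2 :: "'a \<Rightarrow> rat" assume "q1 + q2 = p1 + p2"
    then show "?e p1 \<otimes>\<^bsub>?A\<^esub> ?e p2 = ?e q1 \<otimes>\<^bsub>?A\<^esub> ?e q2"
      by (simp add: LS_semigroup_algebra_def mult_single)
  qed
qed

end

theory Submission
  imports Defs
begin

text \<open>
  Write \<open>F\<close> for the partial sums of a function \<open>\<pi>\<close> and let \<open>u \<sigma>\<close> be the bond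
  joining \<open>\<sigma>\<close> to its successor, with \<open>u = 1\<close> at the maximum. Then \<open>\<pi>\<close> is an
  LS-path if and only if \<open>\<pi> \<ge> 0\<close> and every \<open>u \<sigma> * F \<sigma>\<close> is an integer
  (\<open>LS_paths_iff\<close>). So the LS-paths are the points in the nonnegative orthant of a lattice
  \<open>L\<close> of full rank in \<open>\<rat>\<^sup>S\<close>, and a discrete LS algebra is the semigroup algebra
  of such a cone.

  The last claim has to be derived from the axioms, which mention only products of paths of
  degree one. A path of positive degree splits at height one of its partial sums into a path of
  degree one followed by the rest (\<open>LS_path_split\<close>). This gives canonical forms, and by
  induction on the degree also the multiplication rule \<open>e \<pi> \<otimes> e \<pi>' = e (\<pi> + \<pi>')\<close>
  (\<open>e_add\<close>): a path of degree one is moved past the leading part of the other factor, and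
  what replaces that leading part still precedes everything behind it.

  The coordinate \<open>\<pi> \<sigma> = F \<sigma> - F \<sigma>'\<close>, with \<open>\<sigma>'\<close> the predecessor of \<open>\<sigma>\<close>,
  takes on \<open>L\<close> exactly the multiples of \<open>1 / d \<sigma>\<close>, where \<open>d \<sigma>\<close> is the least
  common multiple of the two bonds at \<open>\<sigma>\<close>. Rescaling by \<open>d\<close> therefore embeds
  \<open>L\<close> in \<open>\<int>\<^sup>S\<close>, and identifies the semigroup algebra with the span of those
  monomials whose exponent vectors come from LS-paths. The group \<open>G\<close> consists of all
  invertible diagonal matrices \<open>t\<close> with \<open>t\<^sup>m = 1\<close> for every such exponent vector
  \<open>m\<close>; diagonal matrices act on monomials by scalars, so \<open>G\<close> fixes these monomials, and
  it fixes no other monomial because \<open>m \<mapsto> exp (2 * pi * i * u \<sigma> * F \<sigma>)\<close> is, for each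
  \<open>\<sigma>\<close>, the evaluation at an element of \<open>G\<close> (\<open>exponents_separated\<close>).

  The choice of \<open>d\<close> as the least common multiple is what excludes pseudo-reflections. Such an
  element of \<open>G\<close> has only one diagonal entry \<open>z\<close> different from \<open>1\<close>, say at
  \<open>\<sigma>\<close>, and then \<open>z\<close> to the power \<open>m \<sigma>\<close> is \<open>1\<close> for all admissible
  \<open>m\<close>. Since these values have greatest common divisor one, \<open>z = 1\<close>
  (\<open>annihilator_no_pseudo_reflection\<close>).
\<close>

section \<open>LS-paths and their partial sums\<close>

text \<open>
  At the maximum the value \<open>1\<close> encodes the condition that the degree is an integer, and at
  the minimum it encodes that the empty partial sum is the integer \<open>0\<close>. In this way all
  elements of the ordered set can be treated alike.
\<close>

definition upper_bond :: "('s::{finite,linorder} \<Rightarrow> 's \<Rightarrow> nat) \<Rightarrow> 's \<Rightarrow> nat" where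
  "upper_bond b \<sigma> = (if \<sigma> = Max UNIV then 1 else b \<sigma> (Min {\<sigma><..}))"

definition lower_bond :: "('s::{finite,linorder} \<Rightarrow> 's \<Rightarrow> nat) \<Rightarrow> 's \<Rightarrow> nat" where
  "lower_bond b \<sigma> = (if \<sigma> = Min UNIV then 1 else upper_bond b (Max {..<\<sigma>}))"

definition partial_sum :: "('s::{finite,linorder} \<Rightarrow> rat) \<Rightarrow> 's \<Rightarrow> rat" where
  "partial_sum \<pi> \<sigma> = (\<Sum>\<rho>\<in>{..\<sigma>}. \<pi> \<rho>)"

definition increments :: "('s::{finite,linorder} \<Rightarrow> rat) \<Rightarrow> 's \<Rightarrow> rat" where
  "increments F \<sigma> = F \<sigma> - (if \<sigma> = Min UNIV then 0 else F (Max {..<\<sigma>}))"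

lemma Max_UNIV_ge [simp]: "(\<sigma>::'s::{finite,linorder}) \<le> Max UNIV"
  by simp

lemma Min_UNIV_le [simp]: "Min UNIV \<le> (\<sigma>::'s::{finite,linorder})"
  by simp

lemma adjacent_in_UNIV_iff:
  "adjacent_in UNIV \<sigma> \<tau> \<longleftrightarrow> \<sigma> \<noteq> Max UNIV \<and> \<tau> = Min {\<sigma><..}"
  for \<sigma> \<tau> :: "'s::{finite,linorder}"
proof
  assume adj: "adjacent_in UNIV \<sigma> \<tau>"
  then have "\<sigma> < \<tau>"
    by (simp add: adjacent_in_def)
  moreover have no: "\<tau> \<le> \<rho>" if "\<sigma> < \<rho>" for \<rho>
    using adj that unfolding adjacent_in_def by (meson UNIV_I leI)
  moreover have "Min {\<sigma><..} = \<tau>"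
    by (rule Min_eqI) (use \<open>\<sigma> < \<tau>\<close> no in auto)
  ultimately show "\<sigma> \<noteq> Max UNIV \<and> \<tau> = Min {\<sigma><..}"
    using Max_UNIV_ge[of \<tau>] by auto
next
  assume R: "\<sigma> \<noteq> Max UNIV \<and> \<tau> = Min {\<sigma><..}"
  then have "{\<sigma><..} \<noteq> {}"
    using Max_UNIV_ge[of \<sigma>] by (metis greaterThan_iff empty_iff le_neq_trans)
  then have "\<sigma> < \<tau>" "\<not> (\<sigma> < \<rho> \<and> \<rho> < \<tau>)" for \<rho>
    using R Min_in[of "{\<sigma><..}"] by auto
  then show "adjacent_in UNIV \<sigma> \<tau>"
    by (simp add: adjacent_in_def)
qed

lemma upper_bond_pos: "is_bonds b \<Longrightarrow> 0 < upper_bond b \<sigma>"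
  by (auto simp: upper_bond_def is_bonds_def adjacent_in_UNIV_iff)

lemma lower_bond_pos: "is_bonds b \<Longrightarrow> 0 < lower_bond b \<sigma>"
  by (simp add: lower_bond_def upper_bond_pos)

lemma predecessor:
  fixes \<sigma> :: "'s::{finite,linorder}"
  assumes "\<sigma> \<noteq> Min UNIV"
  shows "Max {..<\<sigma>} < \<sigma>" and "{..<\<sigma>} = {..Max {..<\<sigma>}}"
proof -
  have "Min UNIV \<in> {..<\<sigma>}"
    using assms Min_UNIV_le[of \<sigma>] by (simp add: less_le)
  then have "{..<\<sigma>} \<noteq> {}"
    by blast
  then show lt: "Max {..<\<sigma>} < \<sigma>"
    using Max_in[of "{..<\<sigma>}"] by simp
  show "{..<\<sigma>} = {..Max {..<\<sigma>}}"
    using lt by auto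
qed

lemma partial_sum_rec:
  "partial_sum \<pi> \<sigma> = \<pi> \<sigma> + (if \<sigma> = Min UNIV then 0 else partial_sum \<pi> (Max {..<\<sigma>}))"
proof -
  have "partial_sum \<pi> \<sigma> = \<pi> \<sigma> + (\<Sum>\<rho>\<in>{..<\<sigma>}. \<pi> \<rho>)"
    unfolding partial_sum_def by (simp flip: ivl_disj_un(2))
  moreover have "{..<\<sigma>} = {}" if "\<sigma> = Min UNIV"
    using that by (auto simp: not_less)
  ultimately show ?thesis
    using predecessor(2)[of \<sigma>] by (auto simp: partial_sum_def)
qed

lemma increments_partial_sum: "increments (partial_sum \<pi>) = \<pi>"
  by (rule ext) (subst increments_def, subst partial_sum_rec, simp)

lemma partial_sum_increments: "partial_sum (increments F) \<sigma> = F \<sigma>"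
proof (induction "card {..<\<sigma>}" arbitrary: \<sigma> rule: less_induct)
  case less
  have "partial_sum (increments F) (Max {..<\<sigma>}) = F (Max {..<\<sigma>})" if "\<sigma> \<noteq> Min UNIV"
  proof (rule less)
    show "card {..<Max {..<\<sigma>}} < card {..<\<sigma>}"
      by (rule psubset_card_mono) (use predecessor(1)[OF that] in auto)
  qed
  then show ?case
    by (subst partial_sum_rec) (simp add: increments_def)
qed

lemma partial_sum_add: "partial_sum (\<pi> + \<pi>') \<sigma> = partial_sum \<pi> \<sigma> + partial_sum \<pi>' \<sigma>"
  by (simp add: partial_sum_def sum.distrib)

text \<open>
  The gcd condition over the support is equivalent to the conditions at all elements, because
  partial sums are constant between elements of the support. The integrality of the degree is the
  condition at the maximum.
\<close>

lemma LS_paths_iff: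
  "\<pi> \<in> LS_paths b \<longleftrightarrow>
     (\<forall>\<sigma>. 0 \<le> \<pi> \<sigma>) \<and> (\<forall>\<sigma>. of_nat (upper_bond b \<sigma>) * partial_sum \<pi> \<sigma> \<in> \<nat>)"
proof -
  have "{..Max UNIV :: 'a} = UNIV"
    by auto
  then have "(\<Sum>\<rho>\<in>UNIV. \<pi> \<rho>) = partial_sum \<pi> (Max UNIV)"
    by (simp add: partial_sum_def)
  moreover have "(\<exists>r. x = of_nat r) \<longleftrightarrow> x \<in> \<nat>" for x :: rat
    by (auto simp: Nats_def)
  moreover have "(\<forall>\<sigma> \<tau>. adjacent_in UNIV \<sigma> \<tau> \<longrightarrow> of_nat (b \<sigma> \<tau>) * partial_sum \<pi> \<sigma> \<in> \<nat>) \<and>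
      partial_sum \<pi> (Max UNIV) \<in> \<nat> \<longleftrightarrow>
      (\<forall>\<sigma>. of_nat (upper_bond b \<sigma>) * partial_sum \<pi> \<sigma> \<in> \<nat>)"
    by (auto simp: upper_bond_def adjacent_in_UNIV_iff split: if_splits)
  ultimately show ?thesis
    unfolding LS_paths_def mem_Collect_eq LS_path_iff partial_sum_def[symmetric] by auto
qed

lemma LS_path_iff_degree:
  "LS_path b r \<pi> \<longleftrightarrow> \<pi> \<in> LS_paths b \<and> partial_sum \<pi> (Max UNIV) = of_nat r"
proof -
  have "{..Max UNIV :: 'a} = UNIV"
    by auto
  then show ?thesis
    by (auto simp: LS_paths_def LS_path_iff partial_sum_def)
qed

text \<open>
  LS-paths are most easily produced from their partial sums: nonnegativity is monotonicity, and
  integrality is a condition at each element separately.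
\<close>

lemma increments_in_LS_paths:
  assumes "mono F" and "\<And>\<sigma>. 0 \<le> F \<sigma>" and "\<And>\<sigma>. of_nat (upper_bond b \<sigma>) * F \<sigma> \<in> \<nat>"
  shows "increments F \<in> LS_paths b"
proof -
  have "0 \<le> increments F \<sigma>" for \<sigma>
    using assms(2) monoD[OF assms(1)] predecessor(1)[of \<sigma>] by (auto simp: increments_def less_imp_le)
  then show ?thesis
    using assms(3) by (simp add: LS_paths_iff partial_sum_increments)
qed

lemma mono_partial_sum: "(\<And>\<sigma>. 0 \<le> \<pi> \<sigma>) \<Longrightarrow> mono (partial_sum \<pi>)"
  unfolding mono_def partial_sum_def by (auto intro!: sum_mono2)

section \<open>Splitting LS-paths into paths of degree one\<close>

definition precedes :: "('s::linorder \<Rightarrow> rat) \<Rightarrow> ('s \<Rightarrow> rat) \<Rightarrow> bool" where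
  "precedes \<pi> \<pi>' \<longleftrightarrow> (\<forall>\<sigma>\<in>supp \<pi>. \<forall>\<tau>\<in>supp \<pi>'. \<sigma> \<le> \<tau>)"

lemma LS_path_nonneg: "LS_path b r \<pi> \<Longrightarrow> 0 \<le> \<pi> \<sigma>"
  by (simp add: LS_path_def)

lemma partial_sum_nonneg: "LS_path b r \<pi> \<Longrightarrow> 0 \<le> partial_sum \<pi> \<sigma>"
  by (simp add: partial_sum_def LS_path_nonneg sum_nonneg)

lemma partial_sum_le_degree:
  assumes "LS_path b r \<pi>"
  shows "partial_sum \<pi> \<sigma> \<le> of_nat r"
  using monoD[OF mono_partial_sum Max_UNIV_ge[of \<sigma>], of \<pi>] assms
  by (simp add: LS_path_iff_degree LS_path_nonneg[OF assms])

lemma partial_sum_strict: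
  assumes "LS_path b r \<pi>" and "\<tau> < \<sigma>" and "\<sigma> \<in> supp \<pi>"
  shows "partial_sum \<pi> \<tau> < partial_sum \<pi> \<sigma>"
proof -
  have "0 < \<pi> \<sigma>"
    using assms LS_path_nonneg[OF assms(1), of \<sigma>] by (simp add: supp_def)
  then show ?thesis
    unfolding partial_sum_def using assms
    by (intro sum_strict_mono2[of _ _ \<sigma>]) (auto simp: LS_path_nonneg[OF assms(1)])
qed

text \<open>
  As long as the partial sums of the whole stay below \<open>1\<close>, everything belongs to
  \<open>q\<close>; so where \<open>\<pi>\<close> has begun, \<open>q\<close> is already used up.
\<close>

lemma precedes_if_partial_sum_min:
  assumes q: "LS_path b 1 q" and \<pi>: "LS_path b r \<pi>"
    and min: "\<And>\<sigma>. partial_sum q \<sigma> = min 1 (partial_sum (q + \<pi>) \<sigma>)"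
  shows "precedes q \<pi>"
  unfolding precedes_def
proof (intro ballI, rule ccontr)
  fix \<sigma> \<tau> assume "\<sigma> \<in> supp q" and \<tau>: "\<tau> \<in> supp \<pi>" and "\<not> \<sigma> \<le> \<tau>"
  then have "partial_sum q \<tau> < 1"
    using partial_sum_strict[OF q not_le_imp_less, of \<sigma> \<tau>] partial_sum_le_degree[OF q, of \<sigma>]
      \<open>\<sigma> \<in> supp q\<close> \<open>\<not> \<sigma> \<le> \<tau>\<close> by simp
  then have "partial_sum \<pi> \<tau> = 0"
    using min[of \<tau>] unfolding partial_sum_add by linarith
  moreover have "\<pi> \<tau> \<le> partial_sum \<pi> \<tau>"
    unfolding partial_sum_def by (rule member_le_sum) (auto simp: LS_path_nonneg[OF \<pi>])
  moreover have "0 < \<pi> \<tau>"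
    using \<tau> LS_path_nonneg[OF \<pi>, of \<tau>] by (simp add: supp_def)
  ultimately show False
    by simp
qed

text \<open>
  Truncating the partial sums at \<open>1\<close> preserves both monotonicity and integrality, and so
  does truncating their excess over \<open>1\<close> at \<open>0\<close>.
\<close>

lemma LS_path_split:
  assumes "LS_path b (Suc r) \<pi>"
  obtains q \<pi>' where "LS_path b 1 q" "LS_path b r \<pi>'" "\<pi> = q + \<pi>'"
    "\<And>\<sigma>. partial_sum q \<sigma> = min 1 (partial_sum \<pi> \<sigma>)"
proof -
  let ?F = "partial_sum \<pi>"
  define q where "q = increments (\<lambda>\<sigma>. min 1 (?F \<sigma>))"
  define \<pi>' where "\<pi>' = increments (\<lambda>\<sigma>. max 0 (?F \<sigma> - 1))"
  have F: "mono ?F" "\<And>\<sigma>. 0 \<le> ?F \<sigma>" "\<And>\<sigma>. of_nat (upper_bond b \<sigma>) * ?F \<sigma> \<in> \<nat>"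
    "?F (Max UNIV) = of_nat (Suc r)"
    using assms mono_partial_sum[of \<pi>] LS_path_nonneg[OF assms] partial_sum_nonneg[OF assms]
    by (auto simp: LS_path_iff_degree LS_paths_iff)
  have "q \<in> LS_paths b"
    unfolding q_def
  proof (rule increments_in_LS_paths)
    fix \<sigma> show "of_nat (upper_bond b \<sigma>) * min 1 (?F \<sigma>) \<in> \<nat>"
      using F(3)[of \<sigma>] by (simp add: min_def)
  qed (use F(1,2) in \<open>auto simp: mono_def min_def intro: order_trans\<close>)
  moreover have "\<pi>' \<in> LS_paths b"
    unfolding \<pi>'_def
  proof (rule increments_in_LS_paths)
    fix \<sigma>
    have "of_nat (upper_bond b \<sigma>) * (?F \<sigma> - 1) \<in> \<int>"
      using F(3)[of \<sigma>] Nats_subset_Ints by (auto simp: right_diff_distrib)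
    then show "of_nat (upper_bond b \<sigma>) * max 0 (?F \<sigma> - 1) \<in> \<nat>"
      by (auto simp: max_def intro: Nats_of_Ints_nonneg)
    show "mono (\<lambda>\<sigma>. max 0 (?F \<sigma> - 1))"
      using F(1) by (fastforce simp: mono_def max_def)
  qed auto
  moreover have sum_q: "partial_sum q \<sigma> = min 1 (?F \<sigma>)" for \<sigma>
    by (simp add: q_def partial_sum_increments)
  moreover have sum_\<pi>': "partial_sum \<pi>' \<sigma> = max 0 (?F \<sigma> - 1)" for \<sigma>
    by (simp add: \<pi>'_def partial_sum_increments)
  moreover have "\<pi> = q + \<pi>'"
  proof -
    have "?F = partial_sum (q + \<pi>')"
      by (rule ext) (simp add: partial_sum_add sum_q sum_\<pi>')
    then show ?thesis
      by (metis increments_partial_sum)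
  qed
  ultimately show thesis
    using F(4) by (intro that[of q \<pi>']) (auto simp: LS_path_iff_degree)
qed

lemma supp_add:
  assumes "LS_path b r \<pi>" "LS_path b s \<pi>'"
  shows "supp (\<pi> + \<pi>') = supp \<pi> \<union> supp \<pi>'"
  using LS_path_nonneg[OF assms(1)] LS_path_nonneg[OF assms(2)]
  by (auto simp: supp_def add_nonneg_eq_0_iff)

lemma LS_path_degree_zero: "LS_path b 0 \<pi> \<Longrightarrow> \<pi> = 0"
  by (auto simp: LS_path_iff fun_eq_iff sum_nonneg_eq_0_iff)

lemma LS_path_sum_list: "standard_seq b ps \<Longrightarrow> \<exists>r. LS_path b r (sum_list ps)"
proof -
  have "\<forall>p\<in>set ps. LS_path b 1 p \<Longrightarrow> \<exists>r. LS_path b r (sum_list ps)"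
  proof (induction ps)
    case Nil
    have "LS_path b 0 (sum_list [])"
      unfolding sum_list.Nil by (rule LS_path_zero)
    then show ?case ..
  next
    case (Cons p ps)
    then obtain r where "LS_path b r (sum_list ps)" and "LS_path b 1 p"
      by auto
    then have "LS_path b (1 + r) (sum_list (p # ps))"
      unfolding sum_list.Cons by (intro LS_path_add)
    then show ?case ..
  qed
  then show "standard_seq b ps \<Longrightarrow> \<exists>r. LS_path b r (sum_list ps)"
    by (simp add: standard_seq_def)
qed

lemma supp_degree_one_nonempty: "LS_path b 1 p \<Longrightarrow> supp p \<noteq> {}"
  by (auto simp: LS_path_def)

lemma standard_seq_Cons:
  assumes p: "LS_path b 1 p" and ps: "standard_seq b ps" and prec: "precedes p (sum_list ps)"
  shows "standard_seq b (p # ps)"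
  unfolding standard_seq_def
proof (intro conjI allI impI)
  show "\<forall>x\<in>set (p # ps). LS_path b 1 x"
    using p ps by (simp add: standard_seq_def)
  fix h assume h: "Suc h < length (p # ps)"
  show "Max (supp ((p # ps) ! h)) \<le> Min (supp ((p # ps) ! Suc h))"
  proof (cases h)
    case 0
    with h obtain q qs where qs: "ps = q # qs"
      by (cases ps) auto
    with ps have q: "LS_path b 1 q" and "standard_seq b qs"
      by (auto simp: standard_seq_def)
    then obtain s where "LS_path b s (sum_list qs)"
      using LS_path_sum_list by blast
    with q qs have "supp q \<subseteq> supp (sum_list ps)"
      by (simp add: supp_add)
    with prec have "\<forall>\<sigma>\<in>supp p. \<forall>\<tau>\<in>supp q. \<sigma> \<le> \<tau>"
      by (auto simp: precedes_def)
    with 0 qs show ?thesis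
      using supp_degree_one_nonempty[OF p] supp_degree_one_nonempty[OF q] by simp
  next
    case (Suc k)
    with ps h show ?thesis
      by (simp add: standard_seq_def)
  qed
qed

lemma standard_seq_Nil: "standard_seq b []"
  by (simp add: standard_seq_def)

text \<open>
  Existence of canonical forms. The splitting is iterated on the remainder, whose support contains
  the support of the next path of degree one.
\<close>

lemma ex_standard_seq: "LS_path b r \<pi> \<Longrightarrow> \<exists>ps. standard_seq b ps \<and> sum_list ps = \<pi>"
proof (induction r arbitrary: \<pi>)
  case 0
  then have "\<pi> = 0"
    by (intro LS_path_degree_zero)
  then show ?case
    by (intro exI[of _ "[]"]) (simp add: standard_seq_Nil)
next
  case (Suc r)
  obtain q \<pi>' where q: "LS_path b 1 q" and \<pi>': "LS_path b r \<pi>'" and sum: "\<pi> = q + \<pi>'"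
    and min: "\<And>\<sigma>. partial_sum q \<sigma> = min 1 (partial_sum \<pi> \<sigma>)"
    using LS_path_split[OF Suc.prems] by blast
  obtain ps where ps: "standard_seq b ps" "sum_list ps = \<pi>'"
    using Suc.IH[OF \<pi>'] by blast
  have "precedes q \<pi>'"
    using precedes_if_partial_sum_min[OF q \<pi>'] min unfolding sum .
  with q ps have "standard_seq b (q # ps)"
    by (intro standard_seq_Cons) auto
  then show ?case
    using ps sum by (intro exI[of _ "q # ps"]) simp
qed

section \<open>The product of basis elements\<close>

context discrete_LS_algebra
begin

lemma e_closed_degree: "LS_path b r \<pi> \<Longrightarrow> e \<pi> \<in> carrier A"
  by (rule e_closed) (auto simp: LS_paths_def)

lemma e_zero: "e 0 = \<one>"
  using canonical_form[OF standard_seq_Nil] by simp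

text \<open>
  Putting \<open>q\<close> in front of the canonical form of \<open>\<pi>\<close> gives the canonical form of
  the sum.
\<close>

lemma e_add_if_precedes:
  assumes q: "LS_path b 1 q" and \<pi>: "LS_path b r \<pi>" and "precedes q \<pi>"
  shows "e q \<otimes> e \<pi> = e (q + \<pi>)"
proof -
  obtain ps where ps: "standard_seq b ps" "sum_list ps = \<pi>"
    using ex_standard_seq[OF \<pi>] by blast
  with assms have "standard_seq b (q # ps)"
    by (intro standard_seq_Cons) auto
  then show ?thesis
    using canonical_form[of "q # ps"] canonical_form[OF ps(1)] ps by simp
qed

text \<open>
  A standard pair is covered by the canonical form, possibly with the factors exchanged. For a
  nonstandard pair, the straightening relation leads to the canonical form of the sum, which the
  splitting provides.
\<close>

lemma e_add_degree_one:
  assumes p1: "LS_path b 1 p1" and p2: "LS_path b 1 p2"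
  shows "e p1 \<otimes> e p2 = e (p1 + p2)"
proof (cases "standard_monomial b {#p1, p2#}")
  case True
  then obtain ps where ps: "mset ps = {#p1, p2#}" "standard_seq b ps"
    by (auto simp: standard_monomial_def)
  then have "length ps = 2"
    by (metis size_mset size_add_mset size_empty numeral_2_eq_2)
  then obtain x y where "ps = [x, y]"
    by (auto simp: length_Suc_conv numeral_2_eq_2)
  with ps have "ps = [p1, p2] \<or> ps = [p2, p1]"
    by (auto simp: add_eq_conv_ex)
  then show ?thesis
  proof
    assume "ps = [p1, p2]"
    then show ?thesis
      using canonical_form[OF ps(2)] e_closed_degree[OF p2] by simp
  next
    assume "ps = [p2, p1]"
    then have "e p2 \<otimes> e p1 = e (p2 + p1)"
      using canonical_form[OF ps(2)] e_closed_degree[OF p1] by simp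
    then show ?thesis
      by (simp only: m_comm[OF e_closed_degree[OF p1] e_closed_degree[OF p2]] add.commute[of p1])
  qed
next
  case False
  have "LS_path b (Suc 1) (p1 + p2)"
    using LS_path_add[OF p1 p2] by simp
  then obtain q1 q2 where q: "LS_path b 1 q1" "LS_path b 1 q2" "p1 + p2 = q1 + q2"
    and "\<And>\<sigma>. partial_sum q1 \<sigma> = min 1 (partial_sum (p1 + p2) \<sigma>)"
    by (rule LS_path_split) blast
  then have prec: "precedes q1 q2"
    by (intro precedes_if_partial_sum_min) auto
  moreover have "standard_seq b [q2]"
    using q by (simp add: standard_seq_def)
  ultimately have "standard_seq b [q1, q2]"
    using standard_seq_Cons[OF q(1), of "[q2]"] by simp
  then show ?thesis
    using straightening[OF p1 p2 False, of q1 q2] q e_add_if_precedes[OF q(1,2) prec] by simp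
qed

text \<open>
  Let \<open>q\<close> be the leading part of \<open>\<pi>\<close> and \<open>\<pi>'\<close> the rest. Straightening
  \<open>p q\<close> to \<open>q1 q2\<close> leaves the product \<open>q1 (q2 \<pi>')\<close>, to which the induction
  hypothesis applies. The result is a canonical form with leading part \<open>q1\<close>, because
  straightening only moves mass of the first factor downwards: \<open>q1\<close> ends no later than
  \<open>q\<close>.
\<close>

lemma e_add_degree_one_any:
  "LS_path b 1 p \<Longrightarrow> LS_path b r \<pi> \<Longrightarrow> e p \<otimes> e \<pi> = e (p + \<pi>)"
proof (induction r arbitrary: p \<pi>)
  case 0
  then have "\<pi> = 0"
    by (intro LS_path_degree_zero)
  then show ?case
    using e_closed_degree[OF 0(1)] by (simp only: e_zero add_0_right r_one)
next
  case (Suc r)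
  note p = \<open>LS_path b 1 p\<close>
  obtain q \<pi>' where q: "LS_path b 1 q" and \<pi>': "LS_path b r \<pi>'" and sum: "\<pi> = q + \<pi>'"
    and min: "\<And>\<sigma>. partial_sum q \<sigma> = min 1 (partial_sum \<pi> \<sigma>)"
    using LS_path_split[OF Suc.prems(2)] by blast
  have q_\<pi>': "precedes q \<pi>'"
    using precedes_if_partial_sum_min[OF q \<pi>'] min unfolding sum .
  have "LS_path b (Suc 1) (p + q)"
    using LS_path_add[OF p q] by simp
  then obtain q1 q2 where q1: "LS_path b 1 q1" and q2: "LS_path b 1 q2"
    and pq: "p + q = q1 + q2" and min1: "\<And>\<sigma>. partial_sum q1 \<sigma> = min 1 (partial_sum (p + q) \<sigma>)"
    by (rule LS_path_split) blast
  have q1_q2: "precedes q1 q2"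
    using precedes_if_partial_sum_min[OF q1 q2] min1 unfolding pq .
  \<comment> \<open>At any element of the support of \<open>\<pi>'\<close>, all of \<open>q\<close> has been collected,
    so the partial sum of \<open>p + q\<close> has reached \<open>1\<close> and \<open>q1\<close> is complete.\<close>
  have "precedes q1 \<pi>'"
    unfolding precedes_def
  proof (intro ballI, rule ccontr)
    fix \<sigma> \<tau> assume \<sigma>: "\<sigma> \<in> supp q1" and "\<tau> \<in> supp \<pi>'" and less: "\<not> \<sigma> \<le> \<tau>"
    then have "\<forall>\<rho>\<in>supp q. \<rho> \<le> \<tau>"
      using q_\<pi>' by (auto simp: precedes_def)
    then have "partial_sum q \<tau> = partial_sum q (Max UNIV)"
      unfolding partial_sum_def by (intro sum.mono_neutral_left) (auto simp: supp_def)
    then have "partial_sum q \<tau> = 1"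
      using q by (simp add: LS_path_iff_degree)
    then have "partial_sum q1 \<tau> = 1"
      using min1[of \<tau>] partial_sum_nonneg[OF p, of \<tau>] unfolding partial_sum_add by linarith
    then show False
      using partial_sum_strict[OF q1 not_le_imp_less[OF less] \<sigma>] partial_sum_le_degree[OF q1, of \<sigma>]
      by simp
  qed
  with q1_q2 have prec: "precedes q1 (q2 + \<pi>')"
    by (auto simp: precedes_def supp_add[OF q2 \<pi>'])
  note closed = e_closed_degree[OF p] e_closed_degree[OF q] e_closed_degree[OF \<pi>']
    e_closed_degree[OF q1] e_closed_degree[OF q2]
  have "e p \<otimes> e \<pi> = (e p \<otimes> e q) \<otimes> e \<pi>'"
    unfolding sum e_add_if_precedes[OF q \<pi>' q_\<pi>', symmetric]
    by (rule m_assoc[symmetric]; rule closed)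
  also have "e p \<otimes> e q = e q1 \<otimes> e q2"
    by (simp only: e_add_degree_one[OF p q] e_add_degree_one[OF q1 q2] pq)
  also have "(e q1 \<otimes> e q2) \<otimes> e \<pi>' = e q1 \<otimes> e (q2 + \<pi>')"
    unfolding Suc.IH[OF q2 \<pi>', symmetric] by (rule m_assoc; rule closed)
  also have "\<dots> = e (q1 + (q2 + \<pi>'))"
    by (rule e_add_if_precedes[OF q1 LS_path_add[OF q2 \<pi>'] prec])
  also have "q1 + (q2 + \<pi>') = p + \<pi>"
    by (simp only: sum add.assoc[symmetric] pq)
  finally show ?case .
qed

lemma e_add: "LS_path b r \<pi> \<Longrightarrow> LS_path b s \<pi>' \<Longrightarrow> e \<pi> \<otimes> e \<pi>' = e (\<pi> + \<pi>')"
proof (induction r arbitrary: \<pi>)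
  case 0
  then have "\<pi> = 0"
    by (intro LS_path_degree_zero)
  then show ?case
    using e_closed_degree[OF 0(2)] by (simp only: e_zero add_0_left l_one)
next
  case (Suc r)
  obtain q \<rho> where q: "LS_path b 1 q" and \<rho>: "LS_path b r \<rho>" and sum: "\<pi> = q + \<rho>"
    using LS_path_split[OF Suc.prems(1)] by blast
  have "e \<pi> \<otimes> e \<pi>' = e q \<otimes> (e \<rho> \<otimes> e \<pi>')"
    unfolding sum e_add_degree_one_any[OF q \<rho>, symmetric]
    by (rule m_assoc) (rule e_closed_degree[OF q] e_closed_degree[OF \<rho>] e_closed_degree[OF Suc.prems(2)])+
  also have "\<dots> = e (q + (\<rho> + \<pi>'))"
    by (simp only: Suc.IH[OF \<rho> Suc.prems(2)] e_add_degree_one_any[OF q LS_path_add[OF \<rho> Suc.prems(2)]])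
  finally show ?case
    by (simp only: sum add.assoc)
qed

end

section \<open>Linear combinations of a multiplicative family\<close>

lemma poly_mapping_keys_induct [consumes 1, case_names zero single add]:
  fixes f :: "'i \<Rightarrow>\<^sub>0 'c::comm_monoid_add"
  assumes "Poly_Mapping.keys f \<subseteq> I"
    and "P 0" and single: "\<And>i a. i \<in> I \<Longrightarrow> P (Poly_Mapping.single i a)"
    and add: "\<And>f g. Poly_Mapping.keys f \<subseteq> I \<Longrightarrow> Poly_Mapping.keys g \<subseteq> I \<Longrightarrow> P f \<Longrightarrow> P g \<Longrightarrow> P (f + g)"
  shows "P f"
proof -
  have "P (\<Sum>i\<in>J. Poly_Mapping.single i (Poly_Mapping.lookup f i)) \<and>
      Poly_Mapping.keys (\<Sum>i\<in>J. Poly_Mapping.single i (Poly_Mapping.lookup f i)) \<subseteq> I"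
    if "finite J" "J \<subseteq> I" for J
    using that
  proof (induction J rule: finite_induct)
    case (insert j J)
    let ?f = "\<Sum>i\<in>J. Poly_Mapping.single i (Poly_Mapping.lookup f i)"
    have "Poly_Mapping.keys (Poly_Mapping.single j (Poly_Mapping.lookup f j) + ?f) \<subseteq> I"
      using insert Poly_Mapping.keys_add[of "Poly_Mapping.single j (Poly_Mapping.lookup f j)" ?f]
      by (auto split: if_splits)
    moreover have "P (Poly_Mapping.single j (Poly_Mapping.lookup f j) + ?f)"
      by (rule add) (use insert in \<open>auto intro: single split: if_splits\<close>)
    ultimately show ?case
      using insert by simp
  qed (use \<open>P 0\<close> in simp)
  from this[of "Poly_Mapping.keys f"] show ?thesis
    using assms(1) by (simp add: sum_single)
qed

text \<open>
  The notions and lemmas below concern any family in any commutative algebra over the complex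
  numbers; they are applied to the family of LS-paths indexed by exponent vectors.
\<close>

locale complex_algebra = algebra complex_field A
  for A :: "(complex, 'a, 'm) module_scheme" (structure)
begin

lemma smult_closed_complex: "x \<in> carrier A \<Longrightarrow> c \<odot> x \<in> carrier A"
  using smult_closed[of c x] by (simp add: complex_field_def)

lemma smult_zero_complex: "x \<in> carrier A \<Longrightarrow> 0 \<odot> x = \<zero>"
  using smult_l_null[of x] by (simp add: complex_field_def)

lemma smult_one_complex: "x \<in> carrier A \<Longrightarrow> 1 \<odot> x = x"
  using smult_one[of x] by (simp add: complex_field_def)

lemma smult_add_complex: "x \<in> carrier A \<Longrightarrow> (c + d) \<odot> x = c \<odot> x \<oplus> d \<odot> x"
  using smult_l_distr[of c d x] by (simp add: complex_field_def)

lemma smult_mult_complex: "x \<in> carrier A \<Longrightarrow> (c * d) \<odot> x = c \<odot> (d \<odot> x)"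
  using smult_assoc1[of c d x] by (simp add: complex_field_def)

lemma mult_smult_complex:
  "x \<in> carrier A \<Longrightarrow> y \<in> carrier A \<Longrightarrow> (c \<odot> x) \<otimes> (d \<odot> y) = (c * d) \<odot> (x \<otimes> y)"
  using smult_assoc2[of c x "d \<odot> y"] smult_assoc2[of d y x]
  by (simp add: smult_closed_complex smult_mult_complex m_comm complex_field_def)

lemma lincomb_superset:
  assumes "finite J" and "Poly_Mapping.keys f \<subseteq> J" and "\<And>i. i \<in> J \<Longrightarrow> v i \<in> carrier A"
  shows "lincomb A v f = finsum A (\<lambda>i. Poly_Mapping.lookup f i \<odot> v i) J"
  unfolding lincomb_def
  by (rule add.finprod_mono_neutral_cong_left)
    (use assms in \<open>auto simp: smult_zero_complex smult_closed_complex in_keys_iff\<close>)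

lemma lincomb_zero: "lincomb A v 0 = \<zero>"
  by (simp add: lincomb_def)

context
  fixes v :: "'i \<Rightarrow> 'a" and I :: "'i set"
  assumes v_closed: "\<And>i. i \<in> I \<Longrightarrow> v i \<in> carrier A"
begin

lemma lincomb_closed: "Poly_Mapping.keys f \<subseteq> I \<Longrightarrow> lincomb A v f \<in> carrier A"
  unfolding lincomb_def using v_closed by (auto intro!: add.finprod_closed smult_closed_complex)

lemma lincomb_single: "i \<in> I \<Longrightarrow> lincomb A v (Poly_Mapping.single i c) = c \<odot> v i"
  using lincomb_superset[of "{i}" "Poly_Mapping.single i c" v] v_closed
  by (simp add: smult_closed_complex)

lemma lincomb_add:
  assumes "Poly_Mapping.keys f \<subseteq> I" "Poly_Mapping.keys g \<subseteq> I"
  shows "lincomb A v (f + g) = lincomb A v f \<oplus> lincomb A v g"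
proof -
  let ?J = "Poly_Mapping.keys f \<union> Poly_Mapping.keys g"
  have v: "v i \<in> carrier A" if "i \<in> ?J" for i
    using that assms v_closed by blast
  have "lincomb A v (f + g) = finsum A (\<lambda>i. Poly_Mapping.lookup (f + g) i \<odot> v i) ?J"
    by (rule lincomb_superset) (use Poly_Mapping.keys_add[of f g] v in auto)
  also have "\<dots> = finsum A (\<lambda>i. Poly_Mapping.lookup f i \<odot> v i \<oplus> Poly_Mapping.lookup g i \<odot> v i) ?J"
    by (rule add.finprod_cong') (use v in \<open>auto simp: lookup_add smult_add_complex smult_closed_complex\<close>)
  also have "\<dots> = lincomb A v f \<oplus> lincomb A v g"
    using v lincomb_superset[of ?J f v] lincomb_superset[of ?J g v]
    by (subst add.finprod_multf) (auto simp: smult_closed_complex)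
  finally show ?thesis .
qed

end

text \<open>
  Convolution of finitely supported functions is the bilinear extension of addition of indices, so
  both sides are bilinear and agree on single indices.
\<close>

lemma lincomb_mult:
  fixes v :: "'i::monoid_add \<Rightarrow> 'a"
  assumes v: "\<And>i. i \<in> I \<Longrightarrow> v i \<in> carrier A"
    and I: "\<And>i j. i \<in> I \<Longrightarrow> j \<in> I \<Longrightarrow> i + j \<in> I"
    and v_add: "\<And>i j. i \<in> I \<Longrightarrow> j \<in> I \<Longrightarrow> v (i + j) = v i \<otimes> v j"
    and f: "Poly_Mapping.keys f \<subseteq> I" and g: "Poly_Mapping.keys g \<subseteq> I"
  shows "lincomb A v (f * g) = lincomb A v f \<otimes> lincomb A v g"
proof -
  have keys: "Poly_Mapping.keys (p * q :: 'i \<Rightarrow>\<^sub>0 complex) \<subseteq> I"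
    if "Poly_Mapping.keys p \<subseteq> I" "Poly_Mapping.keys q \<subseteq> I" for p q
    using that keys_mult[of p q] I by blast
  note lin = lincomb_closed[OF v] lincomb_zero lincomb_single[OF v] lincomb_add[OF v]
  have single_mult: "lincomb A v (Poly_Mapping.single i c * q) = (c \<odot> v i) \<otimes> lincomb A v q"
    if "i \<in> I" "Poly_Mapping.keys q \<subseteq> I" for i c q
    using that(2)
  proof (induction q rule: poly_mapping_keys_induct)
    case zero
    show ?case
      using that(1) by (simp add: lin v smult_closed_complex)
  next
    case (single j d)
    then show ?case
      using that(1) I by (simp add: mult_single lin v v_add mult_smult_complex)
  next
    case (add p q)
    then show ?case
      using that(1) keys[of "Poly_Mapping.single i c"]
      by (simp add: distrib_left lin v smult_closed_complex r_distr)
  qed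
  show ?thesis
    using f
  proof (induction f rule: poly_mapping_keys_induct)
    case zero
    show ?case
      using g by (simp add: lin)
  next
    case (single i c)
    then show ?case
      using g by (simp add: single_mult lin)
  next
    case (add p q)
    then show ?case
      using g keys by (simp add: distrib_right lin l_distr)
  qed
qed

end

section \<open>Diagonal groups and their invariants\<close>

definition diag :: "('s::finite \<Rightarrow> complex) \<Rightarrow> complex ^ 's ^ 's" where
  "diag t = (\<chi> \<sigma> \<tau>. if \<sigma> = \<tau> then t \<sigma> else 0)"

definition monomial_value :: "('s::finite \<Rightarrow> complex) \<Rightarrow> ('s \<Rightarrow>\<^sub>0 nat) \<Rightarrow> complex" where
  "monomial_value t m = (\<Prod>\<sigma>\<in>UNIV. t \<sigma> ^ Poly_Mapping.lookup m \<sigma>)"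

text \<open>
  The Zariski-closed subgroup of the diagonal torus cut out by the monomials with exponents in
  \<open>M\<close>.
\<close>

definition annihilator :: "('s::finite \<Rightarrow>\<^sub>0 nat) set \<Rightarrow> (complex ^ 's ^ 's) set" where
  "annihilator M = diag ` {t. (\<forall>\<sigma>. t \<sigma> \<noteq> 0) \<and> (\<forall>m\<in>M. monomial_value t m = 1)}"

lemma diag_mult: "diag t ** diag s = diag (\<lambda>\<sigma>. t \<sigma> * s \<sigma>)"
  by (simp add: diag_def matrix_matrix_mult_def vec_eq_iff if_distrib[of "\<lambda>x. x * _"] cong: if_cong)

lemma diag_one: "diag (\<lambda>_. 1) = mat 1"
  by (simp add: diag_def mat_def)

lemma group_GL: "group (GL :: (complex ^ 's::finite ^ 's) monoid)"
proof (rule groupI)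
  fix g :: "complex ^ 's ^ 's" assume "g \<in> carrier GL"
  then obtain h where "g ** h = mat 1" "h ** g = mat 1"
    by (auto simp: GL_def invertible_def)
  then show "\<exists>h\<in>carrier GL. h \<otimes>\<^bsub>GL\<^esub> g = \<one>\<^bsub>GL\<^esub>"
    by (auto simp: GL_def invertible_def)
next
  show "\<one>\<^bsub>GL\<^esub> \<in> carrier (GL :: (complex ^ 's ^ 's) monoid)"
    by (auto simp: GL_def invertible_def intro: exI[of _ "mat 1"])
qed (auto simp: GL_def invertible_mult matrix_mul_assoc)

lemma subgroup_annihilator: "subgroup (annihilator M) GL"
proof (rule group.subgroupI[OF group_GL])
  have diag_inv: "diag t ** diag (\<lambda>\<sigma>. inverse (t \<sigma>)) = mat 1"
    "diag (\<lambda>\<sigma>. inverse (t \<sigma>)) ** diag t = mat 1" if "\<forall>\<sigma>. t \<sigma> \<noteq> 0" for t :: "'a \<Rightarrow> complex"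
    using that by (simp_all add: diag_mult flip: diag_one)
  then have carrier: "diag t \<in> carrier GL" if "\<forall>\<sigma>. t \<sigma> \<noteq> 0" for t :: "'a \<Rightarrow> complex"
    using that by (auto simp: GL_def invertible_def)
  then show "annihilator M \<subseteq> carrier GL"
    by (auto simp: annihilator_def)
  show "annihilator M \<noteq> {}"
    by (auto simp: annihilator_def monomial_value_def intro!: exI[of _ "\<lambda>_. 1"])
  fix g assume "g \<in> annihilator M"
  then obtain t where t: "\<forall>\<sigma>. t \<sigma> \<noteq> 0" "\<forall>m\<in>M. monomial_value t m = 1" "g = diag t"
    by (auto simp: annihilator_def)
  have "inv\<^bsub>GL\<^esub> g = diag (\<lambda>\<sigma>. inverse (t \<sigma>))"
    by (rule group.inv_equality[OF group_GL])
      (use t carrier[of t] carrier[of "\<lambda>\<sigma>. inverse (t \<sigma>)"] diag_inv in \<open>auto simp: GL_def\<close>)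
  moreover have "monomial_value (\<lambda>\<sigma>. inverse (t \<sigma>)) m = inverse (monomial_value t m)" for m
    by (simp add: monomial_value_def power_inverse prod_inversef[symmetric] o_def)
  ultimately show "inv\<^bsub>GL\<^esub> g \<in> annihilator M"
    unfolding annihilator_def using t by (intro image_eqI[of _ _ "\<lambda>\<sigma>. inverse (t \<sigma>)"]) auto
  fix h assume "h \<in> annihilator M"
  then obtain s where s: "\<forall>\<sigma>. s \<sigma> \<noteq> 0" "\<forall>m\<in>M. monomial_value s m = 1" "h = diag s"
    by (auto simp: annihilator_def)
  have "monomial_value (\<lambda>\<sigma>. t \<sigma> * s \<sigma>) m = monomial_value t m * monomial_value s m" for m
    by (simp add: monomial_value_def power_mult_distrib prod.distrib)
  with t s show "g \<otimes>\<^bsub>GL\<^esub> h \<in> annihilator M"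
    unfolding annihilator_def
    by (intro image_eqI[of _ _ "\<lambda>\<sigma>. t \<sigma> * s \<sigma>"]) (auto simp: GL_def diag_mult)
qed

lemma comm_group_annihilator: "comm_group (GL\<lparr>carrier := annihilator M\<rparr>)"
proof (rule group.group_comm_groupI)
  show "group (GL\<lparr>carrier := annihilator M\<rparr>)"
    by (rule subgroup.subgroup_is_group[OF subgroup_annihilator group_GL])
qed (auto simp: annihilator_def GL_def diag_mult mult.commute)

lemma monomial_value_single: "monomial_value t (Poly_Mapping.single \<sigma> n) = t \<sigma> ^ n"
proof -
  have "monomial_value t (Poly_Mapping.single \<sigma> n) = (\<Prod>\<rho>\<in>UNIV. if \<rho> = \<sigma> then t \<sigma> ^ n else 1)"
    unfolding monomial_value_def by (rule prod.cong) (auto simp: lookup_single when_def)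
  then show ?thesis
    by simp
qed

text \<open>
  Every diagonal entry is a root of unity of bounded order.
\<close>

lemma finite_annihilator:
  assumes n: "\<And>\<sigma>. 0 < n \<sigma>" and M: "\<And>\<sigma>. Poly_Mapping.single \<sigma> (n \<sigma>) \<in> M"
  shows "finite (annihilator M)"
proof -
  have "{t. (\<forall>\<sigma>. t \<sigma> \<noteq> 0) \<and> (\<forall>m\<in>M. monomial_value t m = 1)} \<subseteq>
      (\<Pi>\<^sub>E \<sigma>\<in>UNIV. {z. z ^ n \<sigma> = 1})"
  proof
    fix t assume "t \<in> {t. (\<forall>\<sigma>. t \<sigma> \<noteq> 0) \<and> (\<forall>m\<in>M. monomial_value t m = 1)}"
    then have "monomial_value t (Poly_Mapping.single \<sigma> (n \<sigma>)) = 1" for \<sigma>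
      using M[of \<sigma>] by blast
    then show "t \<in> (\<Pi>\<^sub>E \<sigma>\<in>UNIV. {z. z ^ n \<sigma> = 1})"
      by (simp add: PiE_iff monomial_value_single)
  qed
  moreover have "finite (\<Pi>\<^sub>E \<sigma>\<in>UNIV. {z :: complex. z ^ n \<sigma> = 1})"
  proof (rule finite_PiE)
    fix \<sigma> show "finite {z :: complex. z ^ n \<sigma> = 1}"
      by (rule finite_roots_unity) (use n[of \<sigma>] in linarith)
  qed simp
  ultimately show ?thesis
    unfolding annihilator_def by (rule finite_imageI[OF finite_subset])
qed

lemma Const_mult_Var: "Const c * Var \<sigma> = Poly_Mapping.single (Poly_Mapping.single \<sigma> 1) c"
  by (simp add: Const_def Var_def mult_single)

lemma single_power:
  "Poly_Mapping.single (Poly_Mapping.single \<sigma> (1::nat)) c ^ n =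
     Poly_Mapping.single (Poly_Mapping.single \<sigma> n) (c ^ n :: 'c::comm_semiring_1)"
proof (induction n)
  case 0
  show ?case
    by (simp only: power_0 single_zero single_one)
next
  case (Suc n)
  show ?case
    by (simp only: power_Suc Suc mult_single single_add[symmetric] plus_1_eq_Suc)
qed

lemma prod_single:
  "finite J \<Longrightarrow> (\<Prod>\<sigma>\<in>J. Poly_Mapping.single (k \<sigma>) (c \<sigma>)) =
     Poly_Mapping.single (\<Sum>\<sigma>\<in>J. k \<sigma>) (\<Prod>\<sigma>\<in>J. c \<sigma> :: 'c::comm_semiring_1)"
  for k :: "'s \<Rightarrow> 'i::comm_monoid_add"
  by (induction J rule: finite_induct) (simp_all add: mult_single)

lemma sum_single_UNIV:
  "(\<Sum>\<sigma>\<in>UNIV. Poly_Mapping.single \<sigma> (n \<sigma>)) = m \<longleftrightarrow> (\<forall>\<sigma>. Poly_Mapping.lookup m \<sigma> = n \<sigma>)"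
  for m :: "'s::finite \<Rightarrow>\<^sub>0 nat"
  by (auto simp: poly_mapping_eq_iff fun_eq_iff lookup_sum lookup_single when_def)

lemma act_diag:
  "act (diag t) f =
     (\<Sum>m\<in>Poly_Mapping.keys f. Poly_Mapping.single m (Poly_Mapping.lookup f m * monomial_value t m))"
proof -
  have "(\<Sum>\<tau>\<in>UNIV. Const (diag t $ \<tau> $ \<sigma>) * Var \<tau>) = Poly_Mapping.single (Poly_Mapping.single \<sigma> 1) (t \<sigma>)"
    for \<sigma>
  proof -
    have "(\<Sum>\<tau>\<in>UNIV. Const (diag t $ \<tau> $ \<sigma>) * Var \<tau>) =
        (\<Sum>\<tau>\<in>UNIV. if \<tau> = \<sigma> then Poly_Mapping.single (Poly_Mapping.single \<sigma> 1) (t \<sigma>) else 0)"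
      by (rule sum.cong) (auto simp: Const_mult_Var diag_def)
    then show ?thesis
      by simp
  qed
  moreover have "(\<Prod>\<sigma>\<in>UNIV. Poly_Mapping.single (Poly_Mapping.single \<sigma> 1) (t \<sigma>) ^ Poly_Mapping.lookup m \<sigma>) =
      Poly_Mapping.single m (monomial_value t m)" for m
  proof -
    have "(\<Sum>\<sigma>\<in>UNIV. Poly_Mapping.single \<sigma> (Poly_Mapping.lookup m \<sigma>)) = m"
      by (subst sum_single_UNIV) simp
    then show ?thesis
      by (simp only: single_power prod_single[OF finite] monomial_value_def)
  qed
  ultimately show ?thesis
    unfolding act_def subst_def by (simp add: Const_def mult_single)
qed

lemma lookup_act_diag:
  "Poly_Mapping.lookup (act (diag t) f) m = Poly_Mapping.lookup f m * monomial_value t m"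
proof -
  have "Poly_Mapping.lookup (act (diag t) f) m = (\<Sum>k\<in>Poly_Mapping.keys f.
      if k = m then Poly_Mapping.lookup f m * monomial_value t m else 0)"
    unfolding act_diag lookup_sum by (rule sum.cong) (auto simp: lookup_single when_def)
  then show ?thesis
    by (simp add: in_keys_iff)
qed

lemma act_diag_eq_iff:
  "act (diag t) f = f \<longleftrightarrow> (\<forall>m\<in>Poly_Mapping.keys f. monomial_value t m = 1)"
  by (auto simp: poly_mapping_eq_iff fun_eq_iff lookup_act_diag in_keys_iff)

text \<open>
  The hypothesis is a form of duality: the diagonal group determines \<open>M\<close>. As the action is
  diagonal in the basis of monomials, a polynomial is invariant exactly when each of its monomials
  is.
\<close>

lemma carrier_invariant_ring_annihilator:
  assumes "\<And>m. m \<notin> M \<Longrightarrow> \<exists>t. (\<forall>\<sigma>. t \<sigma> \<noteq> 0) \<and> (\<forall>k\<in>M. monomial_value t k = 1) \<and> monomial_value t m \<noteq> 1"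
  shows "carrier (invariant_ring (annihilator M)) = {f. Poly_Mapping.keys f \<subseteq> M}"
  using assms by (fastforce simp: invariant_ring_def annihilator_def act_diag_eq_iff)

lemma order_one_prod_linear:
  fixes t :: "'s \<Rightarrow> complex"
  shows "finite J \<Longrightarrow> Polynomial.order 1 (\<Prod>\<sigma>\<in>J. [:- t \<sigma>, 1:]) = card {\<sigma>\<in>J. t \<sigma> = 1}"
proof (induction J rule: finite_induct)
  case (insert \<sigma> J)
  have "Polynomial.order 1 [:- t \<sigma>, 1:] = (if t \<sigma> = 1 then 1 else 0)"
    using order_power_n_n[of "1::complex" 1] by (auto intro: order_0I)
  moreover have "{\<rho> \<in> insert \<sigma> J. t \<rho> = 1} = (if t \<sigma> = 1 then insert \<sigma> {\<rho> \<in> J. t \<rho> = 1} else {\<rho> \<in> J. t \<rho> = 1})"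
    by auto
  moreover have "[:- t \<sigma>, 1:] * (\<Prod>\<sigma>\<in>J. [:- t \<sigma>, 1:]) \<noteq> 0"
    using insert.hyps by (simp del: mult_pCons_left)
  ultimately show ?case
    using insert by (simp add: Polynomial.order_mult del: mult_pCons_left)
qed auto

text \<open>
  The multiplicity of the root \<open>1\<close> of the characteristic polynomial is the number of
  diagonal entries equal to \<open>1\<close>, and it is at least the dimension minus one.
\<close>

lemma pseudo_reflection_diag:
  assumes "pseudo_reflection (diag t)"
  obtains \<sigma> where "\<And>\<rho>. \<rho> \<noteq> \<sigma> \<Longrightarrow> t \<rho> = 1"
proof -
  obtain z where z: "\<And>x. det (mat x - diag t) = (x - 1) ^ (CARD('a) - 1) * (x - z)"
    using assms by (auto simp: pseudo_reflection_def)
  let ?P = "\<Prod>\<sigma>\<in>UNIV. [:- t \<sigma>, 1:]" and ?Q = "[:-1, 1:] ^ (CARD('a) - 1) * [:- z, 1:]"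
  have "det (mat x - diag t) = (\<Prod>\<sigma>\<in>UNIV. x - t \<sigma>)" for x
    by (subst det_diagonal) (auto simp: mat_def diag_def)
  with z have "poly ?P = poly ?Q"
    by (auto simp: fun_eq_iff poly_prod poly_power algebra_simps)
  then have PQ: "?P = ?Q"
    by (simp add: poly_eq_poly_eq_iff)
  have "CARD('a) - 1 \<le> Polynomial.order 1 ?Q"
    by (subst Polynomial.order_mult) (auto simp: order_power_n_n simp del: mult_pCons_left mult_pCons_right)
  then have "CARD('a) - 1 \<le> card {\<sigma>. t \<sigma> = 1}"
    unfolding PQ[symmetric] by (simp add: order_one_prod_linear)
  moreover have "card {\<sigma>. t \<sigma> = 1} + card {\<sigma>. t \<sigma> \<noteq> 1} = CARD('a)"
    using card_Diff_subset[of "{\<sigma>. t \<sigma> = 1}" UNIV] card_mono[of UNIV "{\<sigma>. t \<sigma> = 1}"]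
    by (simp add: Collect_neg_eq Compl_eq_Diff_UNIV)
  ultimately have "card {\<sigma>. t \<sigma> \<noteq> 1} \<le> Suc 0"
    by linarith
  then have "\<exists>\<sigma>. {\<sigma>. t \<sigma> \<noteq> 1} \<subseteq> {\<sigma>}"
    unfolding card_le_Suc0_iff_eq[OF finite] by blast
  then show thesis
    using that by blast
qed

section \<open>Exponent vectors of LS-paths\<close>

definition scale :: "('s::{finite,linorder} \<Rightarrow> 's \<Rightarrow> nat) \<Rightarrow> 's \<Rightarrow> nat" where
  "scale b \<sigma> = lcm (lower_bond b \<sigma>) (upper_bond b \<sigma>)"

definition path_of :: "('s::{finite,linorder} \<Rightarrow> 's \<Rightarrow> nat) \<Rightarrow> ('s \<Rightarrow>\<^sub>0 nat) \<Rightarrow> 's \<Rightarrow> rat" where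
  "path_of b m \<sigma> = of_nat (Poly_Mapping.lookup m \<sigma>) / of_nat (scale b \<sigma>)"

definition exponents :: "('s::{finite,linorder} \<Rightarrow> 's \<Rightarrow> nat) \<Rightarrow> ('s \<Rightarrow>\<^sub>0 nat) set" where
  "exponents b = {m. path_of b m \<in> LS_paths b}"

lemma scale_pos: "is_bonds b \<Longrightarrow> 0 < scale b \<sigma>"
  by (simp add: scale_def lcm_pos_nat lower_bond_pos upper_bond_pos)

lemma path_of_add: "path_of b (m + k) = path_of b m + path_of b k"
  by (rule ext) (simp add: path_of_def lookup_add add_divide_distrib)

lemma path_of_zero: "path_of b 0 = 0"
  by (rule ext) (simp add: path_of_def)

lemma inj_path_of: "is_bonds b \<Longrightarrow> inj (path_of b)"
  by (rule injI) (auto simp: path_of_def fun_eq_iff poly_mapping_eq_iff less_imp_neq[OF scale_pos, symmetric])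

text \<open>
  The value of an LS-path is a difference of two consecutive partial sums. Their denominators
  divide the two bonds at this element, hence also their least common multiple.
\<close>

lemma LS_paths_subset_range_path_of:
  assumes "is_bonds b"
  shows "LS_paths b \<subseteq> range (path_of b)"
proof
  fix \<pi> assume \<pi>: "\<pi> \<in> LS_paths b"
  have "of_nat (scale b \<sigma>) * \<pi> \<sigma> \<in> \<nat>" for \<sigma>
  proof -
    have int: "of_nat (scale b \<sigma>) * partial_sum \<pi> \<rho> \<in> \<int>" if dvd: "upper_bond b \<rho> dvd scale b \<sigma>" for \<rho>
    proof -
      obtain k where "scale b \<sigma> = upper_bond b \<rho> * k"
        using dvd by (rule dvdE)
      moreover have "of_nat k * (of_nat (upper_bond b \<rho>) * partial_sum \<pi> \<rho>) \<in> \<int>"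
      proof (rule Ints_mult[OF Ints_of_nat])
        show "of_nat (upper_bond b \<rho>) * partial_sum \<pi> \<rho> \<in> \<int>"
          using \<pi> Nats_subset_Ints by (auto simp: LS_paths_iff)
      qed
      ultimately show ?thesis
        by (simp add: mult_ac)
    qed
    have "of_nat (scale b \<sigma>) * partial_sum \<pi> \<sigma> \<in> \<int>"
      by (rule int) (simp add: scale_def)
    moreover have "of_nat (scale b \<sigma>) * partial_sum \<pi> (Max {..<\<sigma>}) \<in> \<int>" if "\<sigma> \<noteq> Min UNIV"
      by (rule int) (use that in \<open>simp add: scale_def lower_bond_def\<close>)
    moreover have "\<pi> \<sigma> = partial_sum \<pi> \<sigma> - (if \<sigma> = Min UNIV then 0 else partial_sum \<pi> (Max {..<\<sigma>}))"
      by (subst partial_sum_rec) simp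
    ultimately have "of_nat (scale b \<sigma>) * \<pi> \<sigma> \<in> \<int>"
      by (auto simp: right_diff_distrib)
    moreover have "0 \<le> \<pi> \<sigma>"
      using \<pi> by (simp add: LS_paths_iff)
    ultimately show ?thesis
      by (simp add: Nats_of_Ints_nonneg)
  qed
  then have "\<forall>\<sigma>. \<exists>n. of_nat (scale b \<sigma>) * \<pi> \<sigma> = of_nat n"
    by (auto simp: Nats_def)
  then obtain n where n: "\<And>\<sigma>. of_nat (scale b \<sigma>) * \<pi> \<sigma> = of_nat (n \<sigma>)"
    by metis
  have "Poly_Mapping.lookup (\<Sum>\<sigma>\<in>UNIV. Poly_Mapping.single \<sigma> (n \<sigma>)) \<sigma> = n \<sigma>" for \<sigma>
    using sum_single_UNIV by metis
  then have "path_of b (\<Sum>\<sigma>\<in>UNIV. Poly_Mapping.single \<sigma> (n \<sigma>)) = \<pi>"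
    using scale_pos[OF assms] by (auto simp: path_of_def fun_eq_iff n[symmetric])
  then show "\<pi> \<in> range (path_of b)"
    by blast
qed

lemma exponent_of_increments:
  assumes "is_bonds b" and "mono F" and "\<And>\<sigma>. 0 \<le> F \<sigma>"
    and "\<And>\<sigma>. of_nat (upper_bond b \<sigma>) * F \<sigma> \<in> \<nat>"
  obtains m where "m \<in> exponents b"
    "\<And>\<sigma>. of_nat (Poly_Mapping.lookup m \<sigma>) = of_nat (scale b \<sigma>) * increments F \<sigma>"
proof -
  have inc: "increments F \<in> LS_paths b"
    using assms(2-4) by (rule increments_in_LS_paths)
  then obtain m where m: "increments F = path_of b m"
    using LS_paths_subset_range_path_of[OF assms(1)] by blast
  show thesis
  proof
    show "m \<in> exponents b"
      using inc by (simp add: exponents_def m)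
    show "of_nat (Poly_Mapping.lookup m \<sigma>) = of_nat (scale b \<sigma>) * increments F \<sigma>" for \<sigma>
      using scale_pos[OF assms(1), of \<sigma>] by (simp add: m path_of_def)
  qed
qed

text \<open>
  The partial sums of a path of degree one that starts at \<open>\<sigma>\<close> with the smallest positive
  value that the bond above \<open>\<sigma>\<close> permits, and whose remaining mass lies at the successor. At the maximum the bond is
  \<open>1\<close> and the whole mass lies there.
\<close>

definition jump :: "('s::{finite,linorder} \<Rightarrow> 's \<Rightarrow> nat) \<Rightarrow> 's \<Rightarrow> 's \<Rightarrow> rat" where
  "jump b \<sigma> \<rho> = (if \<rho> < \<sigma> then 0 else if \<rho> = \<sigma> then 1 / of_nat (upper_bond b \<sigma>) else 1)"

lemma exponent_of_jump:
  assumes "is_bonds b"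
  obtains m where "m \<in> exponents b"
    "\<And>\<rho>. of_nat (Poly_Mapping.lookup m \<rho>) = of_nat (scale b \<rho>) * increments (jump b \<sigma>) \<rho>"
proof (rule exponent_of_increments[OF assms])
  have le: "1 / rat_of_nat (upper_bond b \<sigma>) \<le> 1"
    using upper_bond_pos[OF assms, of \<sigma>] by simp
  then show "mono (jump b \<sigma>)"
    by (auto simp: mono_def jump_def)
  show "of_nat (upper_bond b \<rho>) * jump b \<sigma> \<rho> \<in> \<nat>" for \<rho>
    using upper_bond_pos[OF assms, of \<sigma>] by (simp add: jump_def)
qed (auto simp: jump_def that)

lemma single_scale_in_exponents:
  assumes "is_bonds b"
  shows "Poly_Mapping.single \<sigma> (scale b \<sigma>) \<in> exponents b"
proof -
  have "partial_sum (path_of b (Poly_Mapping.single \<sigma> (scale b \<sigma>))) \<rho> = (if \<sigma> \<le> \<rho> then 1 else 0)" for \<rho>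
  proof -
    have "path_of b (Poly_Mapping.single \<sigma> (scale b \<sigma>)) \<upsilon> = (if \<upsilon> = \<sigma> then 1 else 0)" for \<upsilon>
      using scale_pos[OF assms, of \<sigma>] by (simp add: path_of_def lookup_single when_def)
    then show ?thesis
      by (simp add: partial_sum_def)
  qed
  then show ?thesis
    by (simp add: exponents_def LS_paths_iff) (simp add: path_of_def)
qed

section \<open>The group attached to the bonds\<close>

lemma root_of_unity_coprime:
  fixes z :: complex
  assumes "z ^ k = 1" "z ^ l = 1" "coprime k l"
  shows "z = 1"
proof (cases "l = 1")
  case True
  then show ?thesis
    using assms by simp
next
  case False
  then obtain x y where "k * x = l * y + 1"
    using coprime_bezout_strong[OF assms(3)] by blast
  then have "(z ^ k) ^ x = (z ^ l) ^ y * z"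
    by (simp flip: power_mult)
  then show ?thesis
    using assms by simp
qed

text \<open>
  Let \<open>d\<close> be the least common multiple of the bonds \<open>l\<close> and \<open>u\<close> below and above
  the element \<open>\<sigma>\<close> that carries the only entry \<open>z\<close> that may differ from \<open>1\<close>.
  Among the exponents at \<open>\<sigma>\<close> are \<open>d\<close> (unit mass at \<open>\<sigma>\<close>), \<open>d / u\<close>
  (the jump at \<open>\<sigma>\<close>) and \<open>d - d / l\<close> (the jump at the predecessor of \<open>\<sigma>\<close>).
  So \<open>z\<close> is a root of unity of the two coprime orders \<open>d / u\<close> and \<open>d / l\<close>.
\<close>

lemma annihilator_no_pseudo_reflection:
  assumes b: "is_bonds b" and g: "g \<in> annihilator (exponents b)"
  shows "\<not> pseudo_reflection g"
proof
  assume refl: "pseudo_reflection g"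
  obtain t where t: "\<forall>m\<in>exponents b. monomial_value t m = 1" and g_eq: "g = diag t"
    using g by (auto simp: annihilator_def)
  obtain \<sigma> where \<sigma>: "\<And>\<rho>. \<rho> \<noteq> \<sigma> \<Longrightarrow> t \<rho> = 1"
    using refl unfolding g_eq by (rule pseudo_reflection_diag) blast
  have root: "t \<sigma> ^ Poly_Mapping.lookup m \<sigma> = 1" if "m \<in> exponents b" for m
  proof -
    have "monomial_value t m = (\<Prod>\<rho>\<in>{\<sigma>}. t \<rho> ^ Poly_Mapping.lookup m \<rho>)"
      unfolding monomial_value_def by (rule prod.mono_neutral_right) (use \<sigma> in auto)
    with t that show ?thesis
      by simp
  qed
  let ?d = "scale b \<sigma>" and ?u = "upper_bond b \<sigma>" and ?l = "lower_bond b \<sigma>"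
  have d: "t \<sigma> ^ ?d = 1"
    using root[OF single_scale_in_exponents[OF b, of \<sigma>]] by simp
  have pos: "0 < ?d" "0 < ?u" "0 < ?l"
    using b by (simp_all add: scale_pos upper_bond_pos lower_bond_pos)
  have dvd: "?u dvd ?d" "?l dvd ?d"
    by (simp_all add: scale_def)
  have rat_div: "rat_of_nat (i div j) = of_nat i / of_nat j" if "j dvd i" "0 < j" for i j
    using that by (auto elim!: dvdE)
  have "t \<sigma> ^ (?d div ?u) = 1"
  proof -
    obtain m where m: "m \<in> exponents b"
      "\<And>\<rho>. of_nat (Poly_Mapping.lookup m \<rho>) = of_nat (scale b \<rho>) * increments (jump b \<sigma>) \<rho>"
      using exponent_of_jump[OF b] by blast
    have "increments (jump b \<sigma>) \<sigma> = 1 / of_nat ?u"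
      using predecessor(1)[of \<sigma>] by (simp add: increments_def jump_def)
    then have "rat_of_nat (Poly_Mapping.lookup m \<sigma>) = rat_of_nat (?d div ?u)"
      using m(2)[of \<sigma>] by (simp add: rat_div dvd pos)
    then show ?thesis
      using root[OF m(1)] by simp
  qed
  moreover have "t \<sigma> ^ (?d div ?l) = 1"
  proof (cases "\<sigma> = Min UNIV")
    case True
    then show ?thesis
      using d by (simp add: lower_bond_def)
  next
    case False
    let ?\<rho> = "Max {..<\<sigma>}"
    obtain m where m: "m \<in> exponents b"
      "\<And>\<rho>. of_nat (Poly_Mapping.lookup m \<rho>) = of_nat (scale b \<rho>) * increments (jump b ?\<rho>) \<rho>"
      using exponent_of_jump[OF b] by blast
    have "increments (jump b ?\<rho>) \<sigma> = 1 - 1 / of_nat ?l"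
      using less_imp_neq[OF predecessor(1)[OF False]] less_not_sym[OF predecessor(1)[OF False]] False
      by (auto simp: increments_def jump_def lower_bond_def)
    then have "rat_of_nat (Poly_Mapping.lookup m \<sigma>) = of_nat ?d - of_nat ?d / of_nat ?l"
      using m(2)[of \<sigma>] by (simp add: right_diff_distrib)
    then have "rat_of_nat (Poly_Mapping.lookup m \<sigma> + ?d div ?l) = rat_of_nat ?d"
      by (simp add: rat_div dvd pos)
    then have "Poly_Mapping.lookup m \<sigma> + ?d div ?l = ?d"
      unfolding of_nat_eq_iff .
    then show ?thesis
      using d root[OF m(1)] by (metis mult_1 power_add)
  qed
  moreover have "coprime (?d div ?u) (?d div ?l)"
  proof -
    have "gcd ?l ?u \<noteq> 0"
      using pos by simp
    moreover have "?d div ?u = ?l div gcd ?l ?u" "?d div ?l = ?u div gcd ?l ?u"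
      using pos unfolding scale_def lcm_nat_def
      by (simp_all add: div_mult2_eq[symmetric] mult.commute[of _ "gcd ?l ?u"] div_mult_swap dvd_div_mult)
    ultimately show ?thesis
      by (simp add: div_gcd_coprime)
  qed
  ultimately have "t \<sigma> = 1"
    by (rule root_of_unity_coprime)
  with \<sigma> have "t = (\<lambda>_. 1)"
    by (metis ext)
  then have "g = mat 1"
    by (simp add: g_eq diag_one)
  with refl show False
    by (simp add: pseudo_reflection_def)
qed

lemma prod_cis: "finite J \<Longrightarrow> (\<Prod>\<sigma>\<in>J. cis (f \<sigma>)) = cis (\<Sum>\<sigma>\<in>J. f \<sigma>)"
  by (induction J rule: finite_induct) (simp_all add: cis_mult)

lemma cis_2pi_of_rat_eq_1_iff: "cis (2 * pi * of_rat x) = 1 \<longleftrightarrow> x \<in> \<int>"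
proof
  assume "cis (2 * pi * of_rat x) = 1"
  then have "cos (2 * pi * of_rat x) = 1"
    by (metis cis.sel(1) one_complex.sel(1))
  then obtain k :: int where "2 * pi * of_rat x = real_of_int k * 2 * pi"
    unfolding cos_one_2pi_int by blast
  then have "of_rat x = (of_rat (of_int k) :: real)"
    by simp
  then show "x \<in> \<int>"
    unfolding of_rat_eq_iff by simp
next
  assume "x \<in> \<int>"
  then show "cis (2 * pi * of_rat x) = 1"
    by (auto elim!: Ints_cases)
qed

text \<open>
  An exponent vector that does not come from an LS-path violates integrality at some
  \<open>\<sigma>\<close>. The map sending \<open>k\<close> to \<open>u \<sigma>\<close> times the partial sum at \<open>\<sigma>\<close> of
  its path is additive; composed with the exponential it becomes a character, which is evaluation
  at the diagonal matrix \<open>t\<close>. It is trivial on all LS-paths but not on the given vector.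
\<close>

lemma exponents_separated:
  assumes b: "is_bonds b" and m: "m \<notin> exponents b"
  shows "\<exists>t. (\<forall>\<sigma>. t \<sigma> \<noteq> 0) \<and> (\<forall>k\<in>exponents b. monomial_value t k = 1) \<and> monomial_value t m \<noteq> 1"
proof -
  have nonneg: "0 \<le> path_of b k \<sigma>" for k \<sigma>
    by (simp add: path_of_def)
  then obtain \<sigma> where \<sigma>: "of_nat (upper_bond b \<sigma>) * partial_sum (path_of b m) \<sigma> \<notin> \<nat>"
    using m by (auto simp: exponents_def LS_paths_iff)
  define t where
    "t \<rho> = (if \<rho> \<le> \<sigma> then cis (2 * pi * of_rat (of_nat (upper_bond b \<sigma>) / of_nat (scale b \<rho>))) else 1)" for \<rho>
  have "monomial_value t k = cis (2 * pi * of_rat (of_nat (upper_bond b \<sigma>) * partial_sum (path_of b k) \<sigma>))" for k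
  proof -
    have "monomial_value t k = (\<Prod>\<rho>\<in>{..\<sigma>}. t \<rho> ^ Poly_Mapping.lookup k \<rho>)"
      unfolding monomial_value_def by (rule prod.mono_neutral_right) (auto simp: t_def)
    also have "\<dots> = (\<Prod>\<rho>\<in>{..\<sigma>}. cis (2 * pi * of_rat (of_nat (upper_bond b \<sigma>) * path_of b k \<rho>)))"
    proof (rule prod.cong)
      fix \<rho> assume "\<rho> \<in> {..\<sigma>}"
      then have "t \<rho> ^ Poly_Mapping.lookup k \<rho> = cis (real (Poly_Mapping.lookup k \<rho>) *
          (2 * pi * of_rat (of_nat (upper_bond b \<sigma>) / of_nat (scale b \<rho>))))"
        by (simp only: t_def atMost_iff if_True Complex.DeMoivre)
      also have "real (Poly_Mapping.lookup k \<rho>) * (2 * pi * of_rat (of_nat (upper_bond b \<sigma>) / of_nat (scale b \<rho>))) =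
          2 * pi * of_rat (of_nat (upper_bond b \<sigma>) * path_of b k \<rho>)"
        by (simp add: path_of_def of_rat_mult of_rat_divide)
      finally show "t \<rho> ^ Poly_Mapping.lookup k \<rho> =
          cis (2 * pi * of_rat (of_nat (upper_bond b \<sigma>) * path_of b k \<rho>))" .
    qed simp
    also have "\<dots> = cis (\<Sum>\<rho>\<in>{..\<sigma>}. 2 * pi * of_rat (of_nat (upper_bond b \<sigma>) * path_of b k \<rho>))"
      by (rule prod_cis) simp
    also have "(\<Sum>\<rho>\<in>{..\<sigma>}. 2 * pi * of_rat (of_nat (upper_bond b \<sigma>) * path_of b k \<rho>)) =
        2 * pi * of_rat (of_nat (upper_bond b \<sigma>) * partial_sum (path_of b k) \<sigma>)"
      by (simp only: partial_sum_def sum_distrib_left of_rat_sum)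
    finally show ?thesis .
  qed
  then have value_iff: "monomial_value t k = 1 \<longleftrightarrow> of_nat (upper_bond b \<sigma>) * partial_sum (path_of b k) \<sigma> \<in> \<int>" for k
    by (simp only: cis_2pi_of_rat_eq_1_iff)
  show ?thesis
  proof (intro exI conjI allI ballI)
    show "t \<rho> \<noteq> 0" for \<rho>
      by (simp add: t_def)
    show "monomial_value t k = 1" if "k \<in> exponents b" for k
      using that Nats_subset_Ints by (auto simp: value_iff exponents_def LS_paths_iff)
    have "0 \<le> of_nat (upper_bond b \<sigma>) * partial_sum (path_of b m) \<sigma>"
      by (simp add: partial_sum_def nonneg sum_nonneg)
    then show "monomial_value t m \<noteq> 1"
      using \<sigma> Nats_of_Ints_nonneg by (auto simp: value_iff)
  qed
qed

section \<open>The isomorphism\<close>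

text \<open>
  This is the basis property of the LS-paths with the index set changed along the injection
  \<open>path_of b\<close>: pulling finitely supported functions back along it is a bijection between
  those supported on LS-paths and those supported on their exponent vectors.
\<close>

lemma (in discrete_LS_algebra) bij_betw_lincomb_path_of:
  assumes b: "is_bonds b"
  shows "bij_betw (lincomb A (\<lambda>m. e (path_of b m))) {f. Poly_Mapping.keys f \<subseteq> exponents b} (carrier A)"
proof -
  let ?push = "\<lambda>f. \<Sum>m\<in>Poly_Mapping.keys f. Poly_Mapping.single (path_of b m) (Poly_Mapping.lookup f m)"
  let ?pull = "Poly_Mapping.map_key (path_of b)"
  let ?E = "{f :: ('s \<Rightarrow>\<^sub>0 nat) \<Rightarrow>\<^sub>0 complex. Poly_Mapping.keys f \<subseteq> exponents b}"
  let ?L = "{c :: ('s \<Rightarrow> rat) \<Rightarrow>\<^sub>0 complex. Poly_Mapping.keys c \<subseteq> LS_paths b}"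
  note inj = inj_path_of[OF b]
  have range: "LS_paths b \<subseteq> range (path_of b)"
    using LS_paths_subset_range_path_of[OF b] .
  have keys_pull: "Poly_Mapping.keys (?pull c) = path_of b -` Poly_Mapping.keys c" for c :: "('s \<Rightarrow> rat) \<Rightarrow>\<^sub>0 complex"
    using inj by (simp add: keys_map_key)
  have lookup_pull: "Poly_Mapping.lookup (?pull c) m = Poly_Mapping.lookup c (path_of b m)" for c :: "('s \<Rightarrow> rat) \<Rightarrow>\<^sub>0 complex" and m
    using inj by (simp add: map_key.rep_eq)
  have pull: "bij_betw ?pull ?L ?E"
  proof (rule bij_betwI')
    fix c d assume cd: "c \<in> ?L" "d \<in> ?L"
    show "?pull c = ?pull d \<longleftrightarrow> c = d"
    proof
      assume eq: "?pull c = ?pull d"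
      show "c = d"
      proof (rule poly_mapping_eqI)
        fix \<pi> show "Poly_Mapping.lookup c \<pi> = Poly_Mapping.lookup d \<pi>"
        proof (cases "\<pi> \<in> range (path_of b)")
          case True
          then obtain m where "\<pi> = path_of b m"
            by blast
          then show ?thesis
            using lookup_pull[of c m] lookup_pull[of d m] by (simp only: eq)
        next
          case False
          then have "\<pi> \<notin> Poly_Mapping.keys c" "\<pi> \<notin> Poly_Mapping.keys d"
            using cd range by auto
          then show ?thesis
            by (simp add: in_keys_iff)
        qed
      qed
    qed simp
  next
    fix c assume "c \<in> ?L"
    then show "?pull c \<in> ?E"
      by (auto simp: keys_pull exponents_def)
  next
    fix f assume f: "f \<in> ?E"
    have "Poly_Mapping.keys (?push f) \<subseteq> LS_paths b"
    proof -
      have "Poly_Mapping.keys (?push f) \<subseteq>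
          (\<Union>m\<in>Poly_Mapping.keys f. Poly_Mapping.keys (Poly_Mapping.single (path_of b m) (Poly_Mapping.lookup f m)))"
        by (rule keys_sum)
      then show ?thesis
        using f by (fastforce simp: exponents_def split: if_splits)
    qed
    moreover have "?pull (?push f) = f"
    proof (rule poly_mapping_eqI)
      fix m
      have "Poly_Mapping.lookup (?pull (?push f)) m =
          (\<Sum>k\<in>Poly_Mapping.keys f. if k = m then Poly_Mapping.lookup f m else 0)"
        unfolding lookup_pull lookup_sum
        by (rule sum.cong) (use inj in \<open>auto simp: lookup_single when_def dest: injD\<close>)
      then show "Poly_Mapping.lookup (?pull (?push f)) m = Poly_Mapping.lookup f m"
        by (simp add: in_keys_iff)
    qed
    ultimately show "\<exists>c\<in>?L. f = ?pull c"
      by (intro bexI[of _ "?push f"]) auto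
  qed
  have "lincomb A (\<lambda>m. e (path_of b m)) (?pull c) = lincomb A e c" if c: "c \<in> ?L" for c
  proof -
    have "path_of b ` (path_of b -` Poly_Mapping.keys c) = Poly_Mapping.keys c"
      using c range by auto
    moreover have "finsum A (\<lambda>\<pi>. Poly_Mapping.lookup c \<pi> \<odot> e \<pi>) (path_of b ` (path_of b -` Poly_Mapping.keys c)) =
        finsum A (\<lambda>m. Poly_Mapping.lookup c (path_of b m) \<odot> e (path_of b m)) (path_of b -` Poly_Mapping.keys c)"
    proof (rule add.finprod_reindex)
      show "inj_on (path_of b) (path_of b -` Poly_Mapping.keys c)"
        using inj by (rule inj_on_subset) simp
      show "(\<lambda>\<pi>. Poly_Mapping.lookup c \<pi> \<odot> e \<pi>) \<in> path_of b ` (path_of b -` Poly_Mapping.keys c) \<rightarrow> carrier A"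
        using c e_closed smult_closed by (auto simp: complex_field_def)
    qed
    ultimately show ?thesis
      by (simp add: lincomb_def keys_pull lookup_pull)
  qed
  then have "bij_betw (lincomb A (\<lambda>m. e (path_of b m)) \<circ> ?pull) ?L (carrier A)"
    using basis by (subst bij_betw_cong[of _ _ "lincomb A e"]) auto
  then show ?thesis
    using bij_betw_comp_iff[OF pull] by blast
qed

text \<open>
  A monomial is sent to the LS-path obtained by unscaling its exponent vector. This is
  multiplicative because unscaling is additive and LS-paths multiply by addition. Multiplication by
  a scalar is treated as the product with a constant polynomial.
\<close>

lemma (in discrete_LS_algebra) algebra_isomorphic_invariant_ring:
  assumes b: "is_bonds b"
  shows "algebra_isomorphic A (invariant_ring (annihilator (exponents b)))"
proof -
  interpret complex_algebra A
    by unfold_locales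
  let ?v = "\<lambda>m. e (path_of b m)"
  let ?h = "lincomb A ?v"
  let ?B = "invariant_ring (annihilator (exponents b))"
  have B: "carrier ?B = {f. Poly_Mapping.keys f \<subseteq> exponents b}"
    by (rule carrier_invariant_ring_annihilator) (rule exponents_separated[OF b])
  have v: "?v m \<in> carrier A" if "m \<in> exponents b" for m
    using that by (intro e_closed) (simp add: exponents_def)
  have v_add: "?v (m + k) = ?v m \<otimes> ?v k" if mk: "m \<in> exponents b" "k \<in> exponents b" for m k
  proof -
    obtain r s where "LS_path b r (path_of b m)" "LS_path b s (path_of b k)"
      using mk by (auto simp: exponents_def LS_paths_def)
    then show ?thesis
      by (simp only: path_of_add e_add)
  qed
  have exponents_add: "m + k \<in> exponents b" if mk: "m \<in> exponents b" "k \<in> exponents b" for m k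
    using mk LS_path_add unfolding exponents_def LS_paths_def path_of_add mem_Collect_eq by blast
  have zero: "0 \<in> exponents b"
    using LS_path_zero[of b] unfolding exponents_def LS_paths_def path_of_zero mem_Collect_eq by blast
  have mult: "?h (f * g) = ?h f \<otimes> ?h g" if "f \<in> carrier ?B" "g \<in> carrier ?B" for f g
    by (rule lincomb_mult[OF v exponents_add v_add]) (use that B in simp_all)
  have const: "?h (Const c) = c \<odot> \<one>" for c
    using lincomb_single[OF v zero, where c = c] by (simp only: Const_def path_of_zero e_zero)
  have closed: "?h f \<in> carrier A" if "f \<in> carrier ?B" for f
    by (rule lincomb_closed[OF v]) (use that B in simp_all)
  have const_closed: "Const c \<in> carrier ?B" for c
    using zero by (simp add: B Const_def)
  have smult: "?h (c \<odot>\<^bsub>?B\<^esub> f) = c \<odot> ?h f" if f: "f \<in> carrier ?B" for c f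
  proof -
    have "?h (c \<odot>\<^bsub>?B\<^esub> f) = (c \<odot> \<one>) \<otimes> ?h f"
      using mult[OF const_closed f] const by (simp add: invariant_ring_def)
    also have "\<dots> = c \<odot> ?h f"
      using mult_smult_complex[of \<one> "?h f" c 1] closed[OF f] by (simp add: smult_one_complex)
    finally show ?thesis .
  qed
  have mult_B_closed: "f * g \<in> carrier ?B" if "f \<in> carrier ?B" "g \<in> carrier ?B" for f g
    using that keys_mult[of f g] exponents_add unfolding B mem_Collect_eq by blast
  have add_B_closed: "f + g \<in> carrier ?B" if "f \<in> carrier ?B" "g \<in> carrier ?B" for f g
    using that Poly_Mapping.keys_add[of f g] unfolding B mem_Collect_eq by blast
  have smult_B_closed: "c \<odot>\<^bsub>?B\<^esub> f \<in> carrier ?B" if "f \<in> carrier ?B" for c f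
    using mult_B_closed[OF const_closed[of c] that] by (simp add: invariant_ring_def)
  have bij: "bij_betw ?h (carrier ?B) (carrier A)"
    unfolding B by (rule bij_betw_lincomb_path_of[OF b])
  define \<phi> where "\<phi> = inv_into (carrier ?B) ?h"
  have image: "?h ` carrier ?B = carrier A"
    using bij by (rule bij_betw_imp_surj_on)
  have \<phi>_closed: "\<phi> x \<in> carrier ?B" if "x \<in> carrier A" for x
    unfolding \<phi>_def by (rule inv_into_into) (simp only: image that)
  have h_\<phi>: "?h (\<phi> x) = x" if "x \<in> carrier A" for x
    unfolding \<phi>_def by (rule f_inv_into_f) (simp only: image that)
  have \<phi>_eqI: "\<phi> x = f" if "f \<in> carrier ?B" "?h f = x" for x f
    unfolding \<phi>_def that(2)[symmetric] using bij that(1) by (intro inv_into_f_f bij_betw_imp_inj_on)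
  have "\<phi> \<in> ring_hom A ?B"
  proof (rule ring_hom_memI)
    fix x y assume x: "x \<in> carrier A" and y: "y \<in> carrier A"
    have "\<phi> (x \<otimes> y) = \<phi> x * \<phi> y"
      by (rule \<phi>_eqI)
        (simp_all only: mult mult_B_closed \<phi>_closed[OF x] \<phi>_closed[OF y] h_\<phi>[OF x] h_\<phi>[OF y])
    then show "\<phi> (x \<otimes> y) = \<phi> x \<otimes>\<^bsub>?B\<^esub> \<phi> y"
      by (simp add: invariant_ring_def)
    have "?h (\<phi> x + \<phi> y) = ?h (\<phi> x) \<oplus> ?h (\<phi> y)"
      by (rule lincomb_add[OF v]) (use \<phi>_closed[OF x] \<phi>_closed[OF y] B in simp_all)
    then have "\<phi> (x \<oplus> y) = \<phi> x + \<phi> y"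
      by (intro \<phi>_eqI)
        (simp_all only: add_B_closed \<phi>_closed[OF x] \<phi>_closed[OF y] h_\<phi>[OF x] h_\<phi>[OF y])
    then show "\<phi> (x \<oplus> y) = \<phi> x \<oplus>\<^bsub>?B\<^esub> \<phi> y"
      by (simp add: invariant_ring_def)
  next
    have "\<phi> \<one> = Const 1"
      using const[of 1] const_closed[of 1] by (intro \<phi>_eqI) (simp_all add: smult_one_complex)
    then show "\<phi> \<one> = \<one>\<^bsub>?B\<^esub>"
      by (simp add: invariant_ring_def Const_def)
  qed (rule \<phi>_closed)
  then have "\<phi> \<in> ring_iso A ?B"
    unfolding ring_iso_def \<phi>_def using bij_betw_inv_into[OF bij] by blast
  moreover have "\<phi> (c \<odot> x) = c \<odot>\<^bsub>?B\<^esub> \<phi> x" if "x \<in> carrier A" for c x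
    by (rule \<phi>_eqI) (simp_all only: smult_B_closed smult \<phi>_closed[OF that] h_\<phi>[OF that])
  ultimately show ?thesis
    unfolding algebra_isomorphic_def by blast
qed

theorem theorem0p6p1:
  fixes b :: "'s::{finite,linorder} \<Rightarrow> 's \<Rightarrow> nat"
    and A :: "(complex, 'a) module"
    and e :: "('s \<Rightarrow> rat) \<Rightarrow> 'a"
  assumes "is_bonds b"
    and "discrete_LS_algebra b A e"
  shows "\<exists>G :: (complex ^ ('s::{finite,linorder}) ^ ('s::{finite,linorder})) set.
    subgroup G GL \<and> finite G \<and> comm_group (GL\<lparr>carrier := G\<rparr>) \<and>
    (\<forall>g\<in>G. \<not> pseudo_reflection g) \<and>
    algebra_isomorphic A (invariant_ring G)"
proof (intro exI conjI ballI)
  show "finite (annihilator (exponents b))"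
    using scale_pos[OF assms(1)] single_scale_in_exponents[OF assms(1)] by (rule finite_annihilator)
  show "algebra_isomorphic A (invariant_ring (annihilator (exponents b)))"
    using assms by (intro discrete_LS_algebra.algebra_isomorphic_invariant_ring)
qed (use annihilator_no_pseudo_reflection[OF assms(1)] in
    \<open>auto intro: subgroup_annihilator comm_group_annihilator\<close>)

end
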